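(* Assume that $G$ is a finite connected distance-transitive $\rho$-regular graph with vertex set $V$. Consider the meteor process on $G$ with $\sum_{x\in V}M^x_0=|V|$. Then under the stationary distribution $Q$, for any $x\in V$, $$\operatorname{Var}_QM^x_0\le\frac{\rho+1}{\rho-1+2\rho/(|V|-1)}.$$
   Context: All graphs are finite, connected, without loops and multiple edges, with $|V|\ge2$. A graph is distance-transitive if for any two vertices $v,w$ at any distance $i$ and any other two vertices $x,y$ at the same distance, there is an automorphism of the graph that carries $v$ to $x$ and $w$ to $y$. Meteor process: let $N^v$, $v\in V$, be jointly independent rate 1 Poisson processes, independent of the nonnegative initial vector $\mathcal{M}_0=(M^v_0)_{v\in V}$. At a jump time $t$ of $N^v$, $M^v_t=0$, $M^x_t=M^x_{t-}+M^v_{t-}/d_v$ for every neighbor $x$ of $v$ (where $d_v$ is the degree of $v$, here equal to $\rho$), and all other masses are unchanged; masses are constant between jumps. For total mass $|V|$ this Markov process has a unique stationary distribution, denoted $Q$. *)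

theory Defs
  imports "HOL-Probability.Probability" "Graph_Theory.Graph_Theory"
begin

text \<open>
  A finite simple undirected graph is an instance of the locale \<^locale>\<open>graph\<close>: a finite
  symmetric digraph without loops and multiple arcs, each edge being a pair of opposite arcs.
  Hence \<^const>\<open>out_degree\<close> is the usual degree and \<^const>\<open>dominates\<close> is adjacency.
\<close>

definition graph_dist :: "('v, 'e) pre_digraph \<Rightarrow> 'v \<Rightarrow> 'v \<Rightarrow> ereal" where
  "graph_dist G = wf_digraph.\<mu> G (\<lambda>_. 1)"

definition graph_automorphism ::
    "('v, 'e) pre_digraph \<Rightarrow> ('v, 'e, 'v, 'e) digraph_isomorphism \<Rightarrow> bool" where
  "graph_automorphism G \<phi> \<longleftrightarrow> pre_digraph.digraph_isomorphism G \<phi> \<and> app_iso \<phi> G = G"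

definition distance_transitive :: "('v, 'e) pre_digraph \<Rightarrow> bool" where
  "distance_transitive G \<longleftrightarrow>
     (\<forall>v\<in>verts G. \<forall>w\<in>verts G. \<forall>x\<in>verts G. \<forall>y\<in>verts G.
        graph_dist G v w = graph_dist G x y \<longrightarrow>
        (\<exists>\<phi>. graph_automorphism G \<phi> \<and> iso_verts \<phi> v = x \<and> iso_verts \<phi> w = y))"

definition regular_graph :: "('v, 'e) pre_digraph \<Rightarrow> nat \<Rightarrow> bool" where
  "regular_graph G \<rho> \<longleftrightarrow> (\<forall>v\<in>verts G. out_degree G v = \<rho>)"


text \<open>
  Path regularity is only required almost surely. As paths are almost surely nondecreasing,
  the truncated subtraction of natural numbers is the true increment.
\<close>

locale poisson_process = prob_space P for P :: "'w measure" +
  fixes rate :: real and N :: "real \<Rightarrow> 'w \<Rightarrow> nat"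
  assumes rate_pos: "0 < rate"
    and count_measurable: "0 \<le> t \<Longrightarrow> random_variable (count_space UNIV) (N t)"
    and count_start: "AE \<omega> in P. N 0 \<omega> = 0"
    and count_mono: "AE \<omega> in P. \<forall>s t. 0 \<le> s \<longrightarrow> s \<le> t \<longrightarrow> N s \<omega> \<le> N t \<omega>"
    and count_right_continuous:
      "AE \<omega> in P. \<forall>t\<ge>0. ((\<lambda>s. N s \<omega>) \<longlongrightarrow> N t \<omega>) (at_right t)"
    and poisson_increments: "\<lbrakk>0 \<le> s; s < t\<rbrakk> \<Longrightarrow>
      distr P (count_space UNIV) (\<lambda>\<omega>. N t \<omega> - N s \<omega>) = measure_pmf (poisson_pmf (rate * (t - s)))"
    and indep_increments: "\<And>\<tau> :: nat \<Rightarrow> real. \<lbrakk>0 \<le> \<tau> 0; mono \<tau>\<rbrakk> \<Longrightarrow>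
      indep_vars (\<lambda>_. count_space UNIV) (\<lambda>i \<omega>. N (\<tau> (Suc i)) \<omega> - N (\<tau> i) \<omega>) UNIV"

text \<open>For a nondecreasing path this says that the left limit at \<open>t\<close> is less than the value at \<open>t\<close>.\<close>

definition jump_time :: "(real \<Rightarrow> nat) \<Rightarrow> real \<Rightarrow> bool" where
  "jump_time f t \<longleftrightarrow> 0 < t \<and> (\<forall>s. 0 \<le> s \<and> s < t \<longrightarrow> f s < f t)"


definition path_space :: "(real \<Rightarrow> nat) measure" where
  "path_space = (\<Pi>\<^sub>M t\<in>{0..}. count_space UNIV)"

definition config_space :: "('v, 'e) pre_digraph \<Rightarrow> ('v \<Rightarrow> real) measure" where
  "config_space G = (\<Pi>\<^sub>M v\<in>verts G. borel)"

definition meteor_hit :: "('v, 'e) pre_digraph \<Rightarrow> 'v \<Rightarrow> ('v \<Rightarrow> real) \<Rightarrow> 'v \<Rightarrow> real" where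
  "meteor_hit G v m = (\<lambda>x\<in>verts G.
     if x = v then 0
     else if v \<rightarrow>\<^bsub>G\<^esub> x then m x + m v / real (out_degree G v)
     else m x)"

text \<open>
  \<open>N v\<close> is the Poisson clock at \<open>v\<close>, and \<open>M t \<omega> v\<close> is the mass at \<open>v\<close> at time \<open>t\<close>; only times
  \<open>t \<ge> 0\<close> matter. The left limits in \<open>hit\<close> exist almost surely, because by \<open>constant_between\<close> the masses
  are piecewise constant. Simultaneous jumps of two clocks form a null event.
  Independence of \<open>M 0\<close> and the clocks is stated for the generated sigma-algebras, since
  \<^const>\<open>prob_space.indep_var\<close> requires random variables of the same type.
\<close>

locale meteor_process = graph G + prob_space P
  for G :: "('v, 'e) pre_digraph" and P :: "'w measure" +
  fixes N :: "'v \<Rightarrow> real \<Rightarrow> 'w \<Rightarrow> nat" and M :: "real \<Rightarrow> 'w \<Rightarrow> 'v \<Rightarrow> real"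
  assumes poisson_clocks: "v \<in> verts G \<Longrightarrow> poisson_process P 1 (N v)"
    and indep_clocks:
      "indep_vars (\<lambda>_. path_space) (\<lambda>v \<omega>. \<lambda>t\<in>{0..}. N v t \<omega>) (verts G)"
    and mass_measurable: "0 \<le> t \<Longrightarrow> random_variable (config_space G) (M t)"
    and initial_nonneg: "AE \<omega> in P. \<forall>v\<in>verts G. 0 \<le> M 0 \<omega> v"
    and indep_initial:
      "indep_set (sets (vimage_algebra (space P) (M 0) (config_space G)))
         (sets (vimage_algebra (space P) (\<lambda>\<omega>. \<lambda>v\<in>verts G. \<lambda>t\<in>{0..}. N v t \<omega>)
            (\<Pi>\<^sub>M v\<in>verts G. path_space)))"
    and hit: "AE \<omega> in P. \<forall>t. \<forall>v\<in>verts G. jump_time (\<lambda>s. N v s \<omega>) t \<longrightarrow>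
      M t \<omega> = meteor_hit G v (\<lambda>x. Lim (at_left t) (\<lambda>s. M s \<omega> x))"
    and constant_between: "AE \<omega> in P. \<forall>s t. 0 \<le> s \<and> s \<le> t \<and>
      (\<forall>v\<in>verts G. \<forall>u. s < u \<and> u \<le> t \<longrightarrow> \<not> jump_time (\<lambda>r. N v r \<omega>) u) \<longrightarrow> M t \<omega> = M s \<omega>"

text \<open>
  \<open>Q\<close> is a stationary distribution of a Markov process if the process started from \<open>Q\<close> has law
  \<open>Q\<close> at all times. The predicate is stated for a realization \<open>M\<close> of the meteor process on \<open>P\<close>;
  the laws of the \<open>M t\<close> depend on that realization only through the initial law, which is \<open>Q\<close>
  by the case \<open>t = 0\<close>.
\<close>

definition stationary_distribution ::
    "('v, 'e) pre_digraph \<Rightarrow> 'w measure \<Rightarrow> (real \<Rightarrow> 'w \<Rightarrow> 'v \<Rightarrow> real) \<Rightarrow>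
     ('v \<Rightarrow> real) measure \<Rightarrow> bool" where
  "stationary_distribution G P M Q \<longleftrightarrow> (\<forall>t\<ge>0. distr P (config_space G) (M t) = Q)"

end

theory Submission
  imports Defs "HOL-Real_Asymp.Real_Asymp"
begin

text \<open>
  Let \<open>n\<close> be the number of vertices, and let \<open>a (x, y)\<close> be the stationary mean of the product of the
  masses at \<open>x\<close> and \<open>y\<close>. The bound is a statement about this moment matrix: its rows sum to \<open>n\<close>, so
  the means are 1 and the variance at \<open>x\<close> is \<open>a (x, x) - 1\<close>.

  Stationarity turns into linear equations for \<open>a\<close>. In a time \<open>h\<close> there is no hit, or one hit at a
  vertex that is uniform and independent of the initial configuration, or, with probability of order
  \<open>h\<^sup>2\<close>, more than one hit. Letting \<open>h\<close> tend to 0, the sum over \<open>v\<close> of the means of \<open>f\<close> after a hit of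
  \<open>v\<close> equals \<open>n\<close> times the mean of \<open>f\<close> (\<open>stationary_generator\<close>). As a hit is a linear map, applying this
  to products of two masses says that \<open>a\<close> is a stationary measure of a Markov chain on pairs of
  vertices (\<open>pair_moment_balanced\<close>), in which two particles leave a vertex that is hit for independent
  uniform neighbours.

  From every pair of vertices this chain can reach a given pair on the diagonal, so a stationary
  measure is determined by its mass (\<open>balanced_unique\<close>). Hence \<open>a\<close> is invariant under all
  automorphisms of the graph (\<open>balanced_automorphism_invariant\<close>), and by distance-transitivity it has
  one value on the diagonal and one value \<open>b\<close> on the edges. The equations on the diagonal express \<open>b\<close>
  through \<open>a (x, x)\<close>. The equations at pairs of nonadjacent distinct vertices make \<open>a\<close> superharmonic
  there, so \<open>b\<close> is its least value off the diagonal (\<open>balanced_minimum_on_edge\<close>). Therefore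
  \<open>a (x, x) + (n - 1) b\<close> is at most the row sum \<open>n\<close>, and this is the bound
  (\<open>balanced_diagonal_bound\<close>).
\<close>

section \<open>Balanced measures of a finite kernel\<close>

text \<open>
If all row sums of \<open>K\<close> are a positive number \<open>c\<close>, these are the stationary, possibly signed,
measures of the Markov chain with transition matrix \<open>K / c\<close>.
\<close>

definition balanced :: "'s set \<Rightarrow> ('s \<Rightarrow> 's \<Rightarrow> real) \<Rightarrow> real \<Rightarrow> ('s \<Rightarrow> real) \<Rightarrow> bool" where
  "balanced S K c b \<longleftrightarrow> (\<forall>y\<in>S. (\<Sum>x\<in>S. b x * K x y) = c * b y)"

locale finite_kernel =
  fixes S :: "'s set" and K :: "'s \<Rightarrow> 's \<Rightarrow> real" and c :: real
  assumes finite_states: "finite S"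
    and kernel_nonneg: "\<lbrakk>x \<in> S; y \<in> S\<rbrakk> \<Longrightarrow> 0 \<le> K x y"
    and kernel_row_sum: "x \<in> S \<Longrightarrow> (\<Sum>y\<in>S. K x y) = c"
begin

lemma balanced_diff: "balanced S K c a \<Longrightarrow> balanced S K c b \<Longrightarrow> balanced S K c (\<lambda>x. a x - b x)"
  by (simp add: balanced_def left_diff_distrib right_diff_distrib sum_subtractf)

lemma balanced_uminus: "balanced S K c b \<Longrightarrow> balanced S K c (\<lambda>x. - b x)"
  by (simp add: balanced_def sum_negf)

text \<open>
The kernel maps \<open>max 0 b\<close> to something at least \<open>c * max 0 b\<close> in every state, and the two sides have
the same total because of the row sums; so they agree in every state.
\<close>

lemma balanced_positive_part:
  assumes "balanced S K c b"
  shows "balanced S K c (\<lambda>x. max 0 (b x))"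
proof -
  define p where "p = (\<lambda>x. max 0 (b x))"
  define g where "g y = (\<Sum>x\<in>S. p x * K x y)" for y
  have le: "c * p y \<le> g y" if y: "y \<in> S" for y
  proof (cases "b y \<ge> 0")
    case True
    have "c * p y = (\<Sum>x\<in>S. b x * K x y)"
      using assms y True by (simp add: balanced_def p_def)
    also have "\<dots> \<le> g y"
      unfolding g_def p_def using y by (intro sum_mono mult_right_mono kernel_nonneg) auto
    finally show ?thesis .
  next
    case False
    then have "c * p y = 0" by (simp add: p_def)
    also have "0 \<le> g y"
      unfolding g_def p_def using y by (intro sum_nonneg mult_nonneg_nonneg kernel_nonneg) auto
    finally show ?thesis .
  qed
  have "(\<Sum>y\<in>S. g y) = (\<Sum>x\<in>S. p x * (\<Sum>y\<in>S. K x y))"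
    unfolding g_def sum_distrib_left by (rule sum.swap)
  also have "\<dots> = (\<Sum>y\<in>S. c * p y)"
    by (intro sum.cong) (auto simp: kernel_row_sum)
  finally have "(\<Sum>y\<in>S. g y - c * p y) = 0" by (simp add: sum_subtractf)
  then have "\<forall>y\<in>S. g y - c * p y = 0"
    using le by (subst (asm) sum_nonneg_eq_0_iff) (auto simp: finite_states)
  then show ?thesis by (simp add: balanced_def g_def p_def)
qed

lemma balanced_nonneg_support_closed:
  assumes "balanced S K c b" and "\<And>x. x \<in> S \<Longrightarrow> 0 \<le> b x"
    and "(x, d) \<in> {(x, y). x \<in> S \<and> y \<in> S \<and> 0 < K x y}\<^sup>*" and "0 < b x"
  shows "0 < b d"
  using assms(3,4)
proof (induction rule: rtrancl_induct)
  case base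
  then show ?case .
next
  case (step y z)
  then have yz: "y \<in> S" "z \<in> S" "0 < K y z" "0 < b y" by auto
  have "0 < b y * K y z" using yz by simp
  also have "\<dots> \<le> (\<Sum>x\<in>S. b x * K x z)"
    using yz assms(2) kernel_nonneg finite_states
    by (intro member_le_sum[where f = "\<lambda>x. b x * K x z"]) auto
  also have "\<dots> = c * b z" using assms(1) yz by (simp add: balanced_def)
  finally have "c * b z > 0" .
  with assms(2)[OF yz(2)] show ?case
    by (cases "b z = 0") auto
qed

text \<open>
By the two preceding lemmas, if the difference of the two measures is somewhere positive then it is
positive at \<open>d\<close>, and if it is somewhere negative then it is negative at \<open>d\<close>. Hence it has one sign,
and having total zero it vanishes.
\<close>

lemma balanced_unique:
  assumes a: "balanced S K c a" and b: "balanced S K c b"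
    and mass: "(\<Sum>x\<in>S. a x) = (\<Sum>x\<in>S. b x)"
    and reach: "\<And>x. x \<in> S \<Longrightarrow> (x, d) \<in> {(x, y). x \<in> S \<and> y \<in> S \<and> 0 < K x y}\<^sup>*"
    and x: "x \<in> S"
  shows "a x = b x"
proof -
  have no_sign_change: "\<not> (0 < e d \<and> e y < 0)"
    if e: "balanced S K c e" and y: "y \<in> S" for e y
  proof
    assume *: "0 < e d \<and> e y < 0"
    have "0 < max 0 (- e d)"
      using balanced_nonneg_support_closed[OF balanced_positive_part[OF balanced_uminus[OF e]] _ reach[OF y]] *
      by auto
    with * show False by simp
  qed
  have pos_at_d: "0 < e d" if e: "balanced S K c e" and y: "y \<in> S" "0 < e y" for e y
    using balanced_nonneg_support_closed[OF balanced_positive_part[OF e] _ reach[OF y(1)]] y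
    by auto
  define e where "e = (\<lambda>x. a x - b x)"
  have e: "balanced S K c e" unfolding e_def by (intro balanced_diff a b)
  have "(\<Sum>x\<in>S. e x) = 0" unfolding e_def using mass by (simp add: sum_subtractf)
  have le: "e y \<le> 0" if e: "balanced S K c e" and sum0: "(\<Sum>x\<in>S. e x) = 0" and "y \<in> S" for e y
  proof (rule ccontr)
    assume "\<not> e y \<le> 0"
    then have pos: "0 < e y" by simp
    then have "0 < e d" by (rule pos_at_d[OF e \<open>y \<in> S\<close>])
    then have "\<forall>z\<in>S. 0 \<le> e z" using no_sign_change[OF e] by force
    then have "0 < (\<Sum>x\<in>S. e x)"
      using pos \<open>y \<in> S\<close> finite_states by (intro sum_pos2[of S y]) auto
    with sum0 show False by simp
  qed
  have "e x \<le> 0" "- e x \<le> 0"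
    using le[OF e _ x] le[OF balanced_uminus[OF e] _ x] \<open>(\<Sum>x\<in>S. e x) = 0\<close>
    by (simp_all add: sum_negf)
  then show ?thesis by (simp add: e_def)
qed

end

section \<open>Distances and automorphisms\<close>

lemma (in wf_digraph) graph_dist_self:
  assumes "v \<in> verts G"
  shows "graph_dist G v v = 0"
  unfolding graph_dist_def \<mu>_def
proof (rule antisym)
  have "awalk v [] v" using assms by (simp add: awalk_Nil_iff)
  then show "(INF p\<in>{p. awalk v p v}. ereal (awalk_cost (\<lambda>_. 1) p)) \<le> 0"
    by (intro INF_lower2[of "[]"]) (auto simp: awalk_cost_def)
  show "0 \<le> (INF p\<in>{p. awalk v p v}. ereal (awalk_cost (\<lambda>_. 1) p))"
    by (intro INF_greatest) (simp add: awalk_cost_def sum_list_triv)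
qed

lemma (in loopfree_digraph) graph_dist_adjacent:
  assumes "v \<rightarrow>\<^bsub>G\<^esub> w"
  shows "graph_dist G v w = 1"
  unfolding graph_dist_def \<mu>_def
proof (rule antisym)
  obtain e where "e \<in> arcs G" "tail G e = v" "head G e = w" using assms by auto
  then have "awalk v [e] w" by (auto simp: awalk_simps)
  then show "(INF p\<in>{p. awalk v p w}. ereal (awalk_cost (\<lambda>_. 1) p)) \<le> 1"
    by (intro INF_lower2[of "[e]"]) (auto simp: awalk_cost_def one_ereal_def)
  have "v \<noteq> w" using assms adj_not_same by blast
  then show "1 \<le> (INF p\<in>{p. awalk v p w}. ereal (awalk_cost (\<lambda>_. 1) p))"
  proof (intro INF_greatest)
    fix p assume "p \<in> {p. awalk v p w}"
    with \<open>v \<noteq> w\<close> have "p \<noteq> []" by (auto simp: awalk_Nil_iff)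
    then show "1 \<le> ereal (awalk_cost (\<lambda>_. 1) p)"
      by (cases p) (auto simp: awalk_cost_def sum_list_triv one_ereal_def)
  qed
qed

lemma automorphism_bij_betw:
  assumes "graph_automorphism G \<phi>"
  shows "bij_betw (iso_verts \<phi>) (verts G) (verts G)"
  using assms unfolding graph_automorphism_def bij_betw_def pre_digraph.digraph_isomorphism_def
  by (metis verts_app_iso)

lemma (in wf_digraph) automorphism_adjacent_iff:
  assumes "graph_automorphism G \<phi>" and uv: "u \<in> verts G" "v \<in> verts G"
  shows "iso_verts \<phi> u \<rightarrow>\<^bsub>G\<^esub> iso_verts \<phi> v \<longleftrightarrow> u \<rightarrow>\<^bsub>G\<^esub> v"
proof -
  have iso: "digraph_isomorphism \<phi>" and app: "app_iso \<phi> G = G"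
    using assms by (auto simp: graph_automorphism_def)
  have ends: "arcs_ends G = (\<lambda>(u,v). (iso_verts \<phi> u, iso_verts \<phi> v)) ` arcs_ends G"
    using arcs_ends_app_iso_eq[OF iso] app by simp
  have inj: "inj_on (iso_verts \<phi>) (verts G)"
    using iso by (simp add: digraph_isomorphism_def)
  show ?thesis
  proof
    assume "iso_verts \<phi> u \<rightarrow>\<^bsub>G\<^esub> iso_verts \<phi> v"
    then have "(iso_verts \<phi> u, iso_verts \<phi> v) \<in> (\<lambda>(u,v). (iso_verts \<phi> u, iso_verts \<phi> v)) ` arcs_ends G"
      using ends by simp
    then obtain u' v' where e: "u' \<rightarrow>\<^bsub>G\<^esub> v'" "iso_verts \<phi> u = iso_verts \<phi> u'" "iso_verts \<phi> v = iso_verts \<phi> v'"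
      by auto
    then have "u' \<in> verts G" "v' \<in> verts G" by (auto dest: adj_in_verts)
    then have "u = u'" "v = v'" using e(2,3) inj uv by (auto dest: inj_onD)
    with e(1) show "u \<rightarrow>\<^bsub>G\<^esub> v" by simp
  next
    assume "u \<rightarrow>\<^bsub>G\<^esub> v"
    then have "(iso_verts \<phi> u, iso_verts \<phi> v) \<in> (\<lambda>(u,v). (iso_verts \<phi> u, iso_verts \<phi> v)) ` arcs_ends G"
      by (rule image_eqI[rotated]) simp
    then show "iso_verts \<phi> u \<rightarrow>\<^bsub>G\<^esub> iso_verts \<phi> v" using ends by simp
  qed
qed

section \<open>The linear map of a hit\<close>

text \<open>
The matrix, with row \<open>x\<close> and column \<open>z\<close>, of the linear map \<^term>\<open>meteor_hit G v\<close>.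
\<close>

definition hit_coeff :: "('v, 'e) pre_digraph \<Rightarrow> 'v \<Rightarrow> 'v \<Rightarrow> 'v \<Rightarrow> real" where
  "hit_coeff G v x z = (if z = v then (if v \<rightarrow>\<^bsub>G\<^esub> x then 1 / real (out_degree G v) else 0)
     else (if x = z then 1 else 0))"

lemma hit_coeff_nonneg: "0 \<le> hit_coeff G v x z"
  by (simp add: hit_coeff_def)

lemma (in graph) sum_hit_coeff:
  assumes "v \<in> verts G" "x \<in> verts G"
  shows "(\<Sum>z\<in>verts G. hit_coeff G v x z * g z)
    = (if x = v then 0 else g x + (if v \<rightarrow>\<^bsub>G\<^esub> x then g v / real (out_degree G v) else 0))"
proof -
  have loop: "\<not> v \<rightarrow>\<^bsub>G\<^esub> v" using adj_not_same by blast
  have "(\<Sum>z\<in>verts G. hit_coeff G v x z * g z)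
      = (\<Sum>z\<in>verts G. (if z = v then (if v \<rightarrow>\<^bsub>G\<^esub> x then g v / real (out_degree G v) else 0) else 0)
          + (if x = z then (if x = v then 0 else g x) else 0))"
    by (intro sum.cong) (auto simp: hit_coeff_def)
  also have "\<dots> = (if x = v then 0 else g x + (if v \<rightarrow>\<^bsub>G\<^esub> x then g v / real (out_degree G v) else 0))"
    using assms loop by (simp add: sum.distrib)
  finally show ?thesis .
qed

lemma (in graph) meteor_hit_eq_sum:
  assumes "v \<in> verts G" "x \<in> verts G"
  shows "meteor_hit G v m x = (\<Sum>z\<in>verts G. hit_coeff G v x z * m z)"
  unfolding sum_hit_coeff[OF assms] using assms by (simp add: meteor_hit_def)

lemma (in graph) card_out_neighbours: "card {x. v \<rightarrow>\<^bsub>G\<^esub> x} = out_degree G v"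
proof -
  have "bij_betw (head G) (out_arcs G v) {x. v \<rightarrow>\<^bsub>G\<^esub> x}"
    unfolding bij_betw_def
  proof
    show "inj_on (head G) (out_arcs G v)"
      using no_multi_arcs by (auto simp: inj_on_def out_arcs_def arc_to_ends_def)
    show "head G ` out_arcs G v = {x. v \<rightarrow>\<^bsub>G\<^esub> x}"
      by (auto simp: out_arcs_def arcs_ends_def arc_to_ends_def)
  qed
  then show ?thesis by (simp add: bij_betw_same_card out_degree_def)
qed

lemma (in graph) sum_over_neighbours:
  assumes "v \<in> verts G"
  shows "(\<Sum>x\<in>verts G. if v \<rightarrow>\<^bsub>G\<^esub> x then g x else 0) = (\<Sum>x | v \<rightarrow>\<^bsub>G\<^esub> x. g x)"
proof -
  have "{x. v \<rightarrow>\<^bsub>G\<^esub> x} = {x\<in>verts G. v \<rightarrow>\<^bsub>G\<^esub> x}" by (auto dest: adj_in_verts)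
  then show ?thesis by (simp add: sum.inter_filter)
qed

text \<open>
Conservation of mass: the mass that sits at \<open>z\<close> before the hit is somewhere afterwards.
\<close>

lemma (in graph) hit_coeff_column_sum:
  assumes "v \<in> verts G" "z \<in> verts G" and "0 < out_degree G v"
  shows "(\<Sum>x\<in>verts G. hit_coeff G v x z) = 1"
proof (cases "z = v")
  case True
  then have "(\<Sum>x\<in>verts G. hit_coeff G v x z)
      = (\<Sum>x\<in>verts G. if v \<rightarrow>\<^bsub>G\<^esub> x then 1 / real (out_degree G v) else 0)"
    by (simp add: hit_coeff_def)
  also have "\<dots> = (\<Sum>x | v \<rightarrow>\<^bsub>G\<^esub> x. 1 / real (out_degree G v))"
    by (rule sum_over_neighbours[OF assms(1)])
  finally show ?thesis using assms(3) by (simp add: card_out_neighbours)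
next
  case False
  then show ?thesis using assms(2) by (simp add: hit_coeff_def)
qed

section \<open>A chain of two particles\<close>

text \<open>
The sum over \<open>v\<close> of the tensor squares of the hit matrices, with rows and columns exchanged: it
describes two unit particles which, at each hit of a vertex, leave that vertex for independent
uniformly chosen neighbours. The matrix of second moments of a stationary law is balanced for it.
\<close>

definition pair_kernel :: "('v, 'e) pre_digraph \<Rightarrow> 'v \<times> 'v \<Rightarrow> 'v \<times> 'v \<Rightarrow> real" where
  "pair_kernel G p q = (\<Sum>v\<in>verts G. hit_coeff G v (fst q) (fst p) * hit_coeff G v (snd q) (snd p))"

locale connected_regular_graph = graph G for G :: "('v, 'e) pre_digraph" +
  fixes \<rho> :: nat
  assumes connected_graph: "connected G"
    and two_vertices: "2 \<le> card (verts G)"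
    and regular: "regular_graph G \<rho>"
begin

lemma reachable_all: "u \<in> verts G \<Longrightarrow> v \<in> verts G \<Longrightarrow> u \<rightarrow>\<^sup>*\<^bsub>G\<^esub> v"
  using symmetric_connected_imp_strongly_connected[OF sym_arcs connected_graph] by blast

lemma adjacent_sym: "u \<rightarrow>\<^bsub>G\<^esub> v \<longleftrightarrow> v \<rightarrow>\<^bsub>G\<^esub> u"
  by (metis graph_symmetric)

lemma out_degree_eq: "v \<in> verts G \<Longrightarrow> out_degree G v = \<rho>"
  using regular by (simp add: regular_graph_def)

lemma neighbour_exists:
  assumes "v \<in> verts G"
  shows "\<exists>u. v \<rightarrow>\<^bsub>G\<^esub> u"
proof -
  obtain w where "w \<in> verts G" "w \<noteq> v"
    using two_vertices assms by (metis card_le_Suc0_iff_eq finite_verts numeral_2_eq_2 not_less_eq_eq)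
  from reachable_all[OF assms \<open>w \<in> verts G\<close>] show ?thesis
    by (cases rule: converse_reachable_cases) (use \<open>w \<noteq> v\<close> in auto)
qed

lemma degree_pos: "0 < \<rho>"
proof -
  obtain v where v: "v \<in> verts G" using two_vertices by (metis card.empty ex_in_conv not_numeral_le_zero)
  have "{x. v \<rightarrow>\<^bsub>G\<^esub> x} \<noteq> {}" using neighbour_exists[OF v] by auto
  moreover have "finite {x. v \<rightarrow>\<^bsub>G\<^esub> x}"
    by (rule finite_subset[OF _ finite_verts]) (auto dest: adj_in_verts)
  ultimately have "0 < card {x. v \<rightarrow>\<^bsub>G\<^esub> x}" by (simp add: card_gt_0_iff)
  then show ?thesis using out_degree_eq[OF v] by (simp add: card_out_neighbours)
qed

lemma sum_meteor_hit:
  assumes "v \<in> verts G"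
  shows "(\<Sum>x\<in>verts G. meteor_hit G v m x) = (\<Sum>x\<in>verts G. m x)"
proof -
  have "(\<Sum>x\<in>verts G. meteor_hit G v m x)
      = (\<Sum>z\<in>verts G. \<Sum>x\<in>verts G. hit_coeff G v x z * m z)"
    using assms by (subst sum.swap) (simp add: meteor_hit_eq_sum)
  also have "\<dots> = (\<Sum>z\<in>verts G. m z)"
    using assms degree_pos
    by (intro sum.cong) (auto simp: hit_coeff_column_sum out_degree_eq simp flip: sum_distrib_right)
  finally show ?thesis .
qed

lemma pair_kernel_nonneg: "0 \<le> pair_kernel G p q"
  by (simp add: pair_kernel_def sum_nonneg hit_coeff_nonneg)

lemma pair_kernel_row_sum:
  assumes "p \<in> verts G \<times> verts G"
  shows "(\<Sum>q\<in>verts G \<times> verts G. pair_kernel G p q) = real (card (verts G))"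
proof -
  have p: "fst p \<in> verts G" "snd p \<in> verts G" using assms by auto
  have "(\<Sum>q\<in>verts G \<times> verts G. pair_kernel G p q)
      = (\<Sum>v\<in>verts G. \<Sum>q\<in>verts G \<times> verts G. hit_coeff G v (fst q) (fst p) * hit_coeff G v (snd q) (snd p))"
    unfolding pair_kernel_def by (rule sum.swap)
  also have "\<dots> = (\<Sum>v\<in>verts G. 1)"
  proof (intro sum.cong refl)
    fix v assume v: "v \<in> verts G"
    have "(\<Sum>q\<in>verts G \<times> verts G. hit_coeff G v (fst q) (fst p) * hit_coeff G v (snd q) (snd p))
        = (\<Sum>x\<in>verts G. hit_coeff G v x (fst p)) * (\<Sum>y\<in>verts G. hit_coeff G v y (snd p))"
      by (simp add: sum_product sum.cartesian_product case_prod_unfold)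
    then show "(\<Sum>q\<in>verts G \<times> verts G. hit_coeff G v (fst q) (fst p) * hit_coeff G v (snd q) (snd p)) = 1"
      using p v degree_pos by (simp add: hit_coeff_column_sum out_degree_eq)
  qed
  finally show ?thesis by simp
qed

lemma finite_kernel_pair_kernel:
  "finite_kernel (verts G \<times> verts G) (pair_kernel G) (real (card (verts G)))"
  by unfold_locales (simp_all add: pair_kernel_nonneg pair_kernel_row_sum)

abbreviation "pair_step \<equiv>
  {(p, q). p \<in> verts G \<times> verts G \<and> q \<in> verts G \<times> verts G \<and> 0 < pair_kernel G p q}"

lemma pair_kernel_pos:
  assumes "v \<in> verts G" "0 < hit_coeff G v x z" "0 < hit_coeff G v y w"
  shows "0 < pair_kernel G (z, w) (x, y)"
  unfolding pair_kernel_def using assms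
  by (intro sum_pos2[of _ v]) (auto intro: mult_nonneg_nonneg hit_coeff_nonneg)

lemma hit_coeff_neighbour_pos:
  assumes "v \<rightarrow>\<^bsub>G\<^esub> u"
  shows "0 < hit_coeff G v u v"
  using assms degree_pos adj_in_verts[OF assms] by (simp add: hit_coeff_def out_degree_eq)

lemma pair_step_single:
  assumes "z \<rightarrow>\<^bsub>G\<^esub> u" "w \<in> verts G" "w \<noteq> z"
  shows "((z, w), (u, w)) \<in> pair_step"
proof -
  have "0 < hit_coeff G z w w" using assms(3) by (simp add: hit_coeff_def)
  then have "0 < pair_kernel G (z, w) (u, w)"
    using assms adj_in_verts[OF assms(1)] by (intro pair_kernel_pos[of z] hit_coeff_neighbour_pos) auto
  then show ?thesis using assms(2) adj_in_verts[OF assms(1)] by simp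
qed

lemma pair_step_joint:
  assumes "z \<rightarrow>\<^bsub>G\<^esub> u"
  shows "((z, z), (u, u)) \<in> pair_step"
  using assms adj_in_verts[OF assms]
  by (auto intro!: pair_kernel_pos[of z] hit_coeff_neighbour_pos)

text \<open>
One particle walks along a path to the other one; from then on they can move together, because two
particles at the same vertex may choose the same neighbour.
\<close>

lemma pairs_reach_diagonal:
  assumes "z \<in> verts G" "w \<in> verts G" "d \<in> verts G"
  shows "((z, w), (d, d)) \<in> pair_step\<^sup>*"
proof -
  have meet: "((z, w), (w, w)) \<in> pair_step\<^sup>*"
    using reachable_all[OF assms(1,2)]
  proof (induction rule: converse_reachable_induct)
    case base
    show ?case by simp
  next
    case (step x y)
    show ?case
    proof (cases "x = w")
      case False
      then have "((x, w), (y, w)) \<in> pair_step"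
        using step(1) assms(2) by (intro pair_step_single) auto
      then show ?thesis using step(3) by (rule converse_rtrancl_into_rtrancl)
    qed simp
  qed
  have "((w, w), (d, d)) \<in> pair_step\<^sup>*"
    using reachable_all[OF assms(2,3)]
  proof (induction rule: converse_reachable_induct)
    case base
    show ?case by simp
  next
    case (step x y)
    from pair_step_joint[OF step(1)] step(3) show ?case by (rule converse_rtrancl_into_rtrancl)
  qed
  with meet show ?thesis by (rule rtrancl_trans)
qed

lemma hit_coeff_automorphism:
  assumes "graph_automorphism G \<phi>" "v \<in> verts G" "x \<in> verts G" "z \<in> verts G"
  shows "hit_coeff G (iso_verts \<phi> v) (iso_verts \<phi> x) (iso_verts \<phi> z) = hit_coeff G v x z"
proof -
  have inj: "inj_on (iso_verts \<phi>) (verts G)" and "iso_verts \<phi> v \<in> verts G"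
    using automorphism_bij_betw[OF assms(1)] assms(2) by (auto simp: bij_betw_def)
  then show ?thesis
    using assms by (simp add: hit_coeff_def automorphism_adjacent_iff out_degree_eq inj_on_eq_iff)
qed

lemma pair_kernel_automorphism:
  assumes \<phi>: "graph_automorphism G \<phi>" and "p \<in> verts G \<times> verts G" "q \<in> verts G \<times> verts G"
  shows "pair_kernel G (map_prod (iso_verts \<phi>) (iso_verts \<phi>) p) (map_prod (iso_verts \<phi>) (iso_verts \<phi>) q)
    = pair_kernel G p q"
proof -
  let ?f = "iso_verts \<phi>"
  have pq: "fst p \<in> verts G" "snd p \<in> verts G" "fst q \<in> verts G" "snd q \<in> verts G"
    using assms by auto
  have "pair_kernel G (map_prod ?f ?f p) (map_prod ?f ?f q)
      = (\<Sum>v\<in>verts G. hit_coeff G v (?f (fst q)) (?f (fst p)) * hit_coeff G v (?f (snd q)) (?f (snd p)))"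
    by (simp add: pair_kernel_def)
  also have "\<dots> = (\<Sum>v\<in>verts G. hit_coeff G (?f v) (?f (fst q)) (?f (fst p)) * hit_coeff G (?f v) (?f (snd q)) (?f (snd p)))"
    by (rule sum.reindex_bij_betw[OF automorphism_bij_betw[OF \<phi>], symmetric])
  also have "\<dots> = pair_kernel G p q"
    unfolding pair_kernel_def
    by (intro sum.cong refl arg_cong2[where f = "(*)"] hit_coeff_automorphism[OF \<phi>] pq)
  finally show ?thesis .
qed

text \<open>
An automorphism turns a balanced measure into a balanced measure of the same mass, and there is
only one.
\<close>

lemma balanced_automorphism_invariant:
  assumes bal: "balanced (verts G \<times> verts G) (pair_kernel G) (real (card (verts G))) a"
    and \<phi>: "graph_automorphism G \<phi>" and "x \<in> verts G" "y \<in> verts G"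
  shows "a (iso_verts \<phi> x, iso_verts \<phi> y) = a (x, y)"
proof -
  interpret finite_kernel "verts G \<times> verts G" "pair_kernel G" "real (card (verts G))"
    by (rule finite_kernel_pair_kernel)
  let ?V = "verts G \<times> verts G" and ?\<Phi> = "map_prod (iso_verts \<phi>) (iso_verts \<phi>)"
  have bij: "bij_betw ?\<Phi> ?V ?V"
    by (rule bij_betw_map_prod[OF automorphism_bij_betw[OF \<phi>] automorphism_bij_betw[OF \<phi>]])
  have mem: "?\<Phi> p \<in> ?V" if "p \<in> ?V" for p
    using bij that by (rule bij_betw_apply)
  have bal': "balanced ?V (pair_kernel G) (real (card (verts G))) (\<lambda>p. a (?\<Phi> p))"
    unfolding balanced_def
  proof
    fix q assume q: "q \<in> ?V"
    have "(\<Sum>p\<in>?V. a (?\<Phi> p) * pair_kernel G p q) = (\<Sum>p\<in>?V. a (?\<Phi> p) * pair_kernel G (?\<Phi> p) (?\<Phi> q))"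
      using q by (intro sum.cong refl) (simp only: pair_kernel_automorphism[OF \<phi>])
    also have "\<dots> = (\<Sum>p\<in>?V. a p * pair_kernel G p (?\<Phi> q))"
      by (rule sum.reindex_bij_betw[OF bij])
    also have "\<dots> = real (card (verts G)) * a (?\<Phi> q)"
      using bal[unfolded balanced_def] mem[OF q] by (rule bspec)
    finally show "(\<Sum>p\<in>?V. a (?\<Phi> p) * pair_kernel G p q) = real (card (verts G)) * a (?\<Phi> q)" .
  qed
  have "a (?\<Phi> (x, y)) = a (x, y)"
  proof (rule balanced_unique[OF bal' bal])
    show "(\<Sum>p\<in>?V. a (?\<Phi> p)) = (\<Sum>p\<in>?V. a p)" by (rule sum.reindex_bij_betw[OF bij])
    show "(p, (x, x)) \<in> pair_step\<^sup>*" if "p \<in> ?V" for p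
      using that assms(3) pairs_reach_diagonal[of "fst p" "snd p" x]
      by (metis mem_Times_iff prod.collapse)
  qed (use assms in auto)
  then show ?thesis by simp
qed

end

section \<open>Balanced pair measures of a distance-transitive graph\<close>

context connected_regular_graph
begin

text \<open>
The inflow into a pair, sorted by the vertex \<open>v\<close> that is hit: none if \<open>v\<close> belongs to the pair, and
otherwise the four terms of the expanded product of the masses at \<open>x\<close> and \<open>y\<close> after the hit.
\<close>

lemma pair_flow:
  fixes a :: "'v \<times> 'v \<Rightarrow> real"
  assumes x: "x \<in> verts G" and y: "y \<in> verts G"
  shows "(\<Sum>p\<in>verts G \<times> verts G. a p * pair_kernel G p (x, y))
    = (\<Sum>v\<in>verts G. if v = x \<or> v = y then 0 else a (x, y)
        + (if v \<rightarrow>\<^bsub>G\<^esub> x then a (v, y) / real \<rho> else 0) + (if v \<rightarrow>\<^bsub>G\<^esub> y then a (x, v) / real \<rho> else 0)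
        + (if v \<rightarrow>\<^bsub>G\<^esub> x \<and> v \<rightarrow>\<^bsub>G\<^esub> y then a (v, v) / (real \<rho>)\<^sup>2 else 0))"
proof -
  have "(\<Sum>p\<in>verts G \<times> verts G. a p * pair_kernel G p (x, y))
      = (\<Sum>v\<in>verts G. \<Sum>p\<in>verts G \<times> verts G. a p * (hit_coeff G v x (fst p) * hit_coeff G v y (snd p)))"
    unfolding pair_kernel_def sum_distrib_left by (subst sum.swap) simp
  also have "\<dots> = (\<Sum>v\<in>verts G. if v = x \<or> v = y then 0 else a (x, y)
        + (if v \<rightarrow>\<^bsub>G\<^esub> x then a (v, y) / real \<rho> else 0) + (if v \<rightarrow>\<^bsub>G\<^esub> y then a (x, v) / real \<rho> else 0)
        + (if v \<rightarrow>\<^bsub>G\<^esub> x \<and> v \<rightarrow>\<^bsub>G\<^esub> y then a (v, v) / (real \<rho>)\<^sup>2 else 0))"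
  proof (intro sum.cong refl)
    fix v assume v: "v \<in> verts G"
    define g where "g z = (if y = v then 0 else a (z, y) + (if v \<rightarrow>\<^bsub>G\<^esub> y then a (z, v) / real \<rho> else 0))" for z
    have "(\<Sum>p\<in>verts G \<times> verts G. a p * (hit_coeff G v x (fst p) * hit_coeff G v y (snd p)))
        = (\<Sum>z\<in>verts G. \<Sum>w\<in>verts G. a (z, w) * (hit_coeff G v x z * hit_coeff G v y w))"
      by (simp add: sum.cartesian_product case_prod_unfold)
    also have "\<dots> = (\<Sum>z\<in>verts G. hit_coeff G v x z * (\<Sum>w\<in>verts G. hit_coeff G v y w * a (z, w)))"
      by (simp add: sum_distrib_left mult_ac)
    also have "\<dots> = (if x = v then 0 else g x + (if v \<rightarrow>\<^bsub>G\<^esub> x then g v / real \<rho> else 0))"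
      unfolding sum_hit_coeff[OF v y] out_degree_eq[OF v] g_def[symmetric]
      using sum_hit_coeff[OF v x, of g] by (simp only: out_degree_eq[OF v])
    finally show "(\<Sum>p\<in>verts G \<times> verts G. a p * (hit_coeff G v x (fst p) * hit_coeff G v y (snd p)))
        = (if v = x \<or> v = y then 0 else a (x, y)
          + (if v \<rightarrow>\<^bsub>G\<^esub> x then a (v, y) / real \<rho> else 0) + (if v \<rightarrow>\<^bsub>G\<^esub> y then a (x, v) / real \<rho> else 0)
          + (if v \<rightarrow>\<^bsub>G\<^esub> x \<and> v \<rightarrow>\<^bsub>G\<^esub> y then a (v, v) / (real \<rho>)\<^sup>2 else 0))"
      by (auto simp: g_def power2_eq_square add_divide_distrib)
  qed
  finally show ?thesis .
qed

lemma card_in_neighbours: "x \<in> verts G \<Longrightarrow> card {v. v \<rightarrow>\<^bsub>G\<^esub> x} = \<rho>"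
  using card_out_neighbours[of x] out_degree_eq[of x] by (simp add: adjacent_sym)

lemma sum_over_in_neighbours:
  "x \<in> verts G \<Longrightarrow> (\<Sum>v\<in>verts G. if v \<rightarrow>\<^bsub>G\<^esub> x then g v else 0) = (\<Sum>v | v \<rightarrow>\<^bsub>G\<^esub> x. g v)"
  using sum_over_neighbours[of x g] by (simp add: adjacent_sym)

lemma finite_in_neighbours: "finite {v. v \<rightarrow>\<^bsub>G\<^esub> x}"
  by (rule finite_subset[OF _ finite_verts]) (auto dest: adj_in_verts)

lemma balanced_diagonal:
  fixes a :: "'v \<times> 'v \<Rightarrow> real"
  assumes bal: "balanced (verts G \<times> verts G) (pair_kernel G) (real (card (verts G))) a"
    and x: "x \<in> verts G"
  shows "a (x, x) = (\<Sum>v | v \<rightarrow>\<^bsub>G\<^esub> x. a (v, x) / real \<rho> + a (x, v) / real \<rho> + a (v, v) / (real \<rho>)\<^sup>2)"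
proof -
  define F where "F v = a (v, x) / real \<rho> + a (x, v) / real \<rho> + a (v, v) / (real \<rho>)\<^sup>2" for v
  have loop: "\<not> x \<rightarrow>\<^bsub>G\<^esub> x" using adj_not_same by blast
  have "real (card (verts G)) * a (x, x) = (\<Sum>p\<in>verts G \<times> verts G. a p * pair_kernel G p (x, x))"
    using bal x by (simp add: balanced_def)
  also have "\<dots> = (\<Sum>v\<in>verts G. a (x, x) - (if v = x then a (x, x) else 0) + (if v \<rightarrow>\<^bsub>G\<^esub> x then F v else 0))"
    unfolding pair_flow[OF x x] using loop by (intro sum.cong) (auto simp: F_def)
  also have "\<dots> = real (card (verts G)) * a (x, x) - a (x, x) + (\<Sum>v | v \<rightarrow>\<^bsub>G\<^esub> x. F v)"
    using x by (simp add: sum.distrib sum_subtractf sum_over_in_neighbours)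
  finally show ?thesis by (simp add: F_def)
qed

text \<open>
If \<open>x\<close> and \<open>y\<close> are not adjacent, then no hit of one sends mass to the other, so all neighbours of \<open>x\<close>
and of \<open>y\<close> contribute to the balance at \<open>(x, y)\<close>. The inequality drops the nonnegative diagonal
terms that come from common neighbours.
\<close>

lemma balanced_nonadjacent_superharmonic:
  fixes a :: "'v \<times> 'v \<Rightarrow> real"
  assumes bal: "balanced (verts G \<times> verts G) (pair_kernel G) (real (card (verts G))) a"
    and nonneg: "\<And>v. v \<in> verts G \<Longrightarrow> 0 \<le> a (v, v)"
    and x: "x \<in> verts G" and y: "y \<in> verts G" and "x \<noteq> y" and nonadj: "\<not> x \<rightarrow>\<^bsub>G\<^esub> y"
  shows "(\<Sum>v | v \<rightarrow>\<^bsub>G\<^esub> x. a (v, y)) + (\<Sum>v | v \<rightarrow>\<^bsub>G\<^esub> y. a (x, v)) \<le> 2 * real \<rho> * a (x, y)"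
proof -
  have loop: "\<not> v \<rightarrow>\<^bsub>G\<^esub> v" for v using adj_not_same by blast
  have nonadj': "\<not> y \<rightarrow>\<^bsub>G\<^esub> x" using nonadj adjacent_sym by blast
  have "real (card (verts G)) * a (x, y) - a (x, y) - a (x, y)
        + ((\<Sum>v | v \<rightarrow>\<^bsub>G\<^esub> x. a (v, y) / real \<rho>) + (\<Sum>v | v \<rightarrow>\<^bsub>G\<^esub> y. a (x, v) / real \<rho>))
      = (\<Sum>v\<in>verts G. a (x, y) - (if v = x then a (x, y) else 0) - (if v = y then a (x, y) else 0)
          + ((if v \<rightarrow>\<^bsub>G\<^esub> x then a (v, y) / real \<rho> else 0) + (if v \<rightarrow>\<^bsub>G\<^esub> y then a (x, v) / real \<rho> else 0)))"
    using x y by (simp add: sum.distrib sum_subtractf sum_over_in_neighbours)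
  also have "\<dots> \<le> (\<Sum>v\<in>verts G. if v = x \<or> v = y then 0 else a (x, y)
        + (if v \<rightarrow>\<^bsub>G\<^esub> x then a (v, y) / real \<rho> else 0) + (if v \<rightarrow>\<^bsub>G\<^esub> y then a (x, v) / real \<rho> else 0)
        + (if v \<rightarrow>\<^bsub>G\<^esub> x \<and> v \<rightarrow>\<^bsub>G\<^esub> y then a (v, v) / (real \<rho>)\<^sup>2 else 0))"
    using \<open>x \<noteq> y\<close> nonadj nonadj' loop nonneg by (intro sum_mono) auto
  also have "\<dots> = real (card (verts G)) * a (x, y)"
    using bal x y unfolding pair_flow[OF x y, symmetric] by (simp add: balanced_def)
  finally have "((\<Sum>v | v \<rightarrow>\<^bsub>G\<^esub> x. a (v, y)) + (\<Sum>v | v \<rightarrow>\<^bsub>G\<^esub> y. a (x, v))) / real \<rho> \<le> 2 * a (x, y)"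
    by (simp add: sum_divide_distrib add_divide_distrib)
  then show ?thesis using degree_pos by (simp add: divide_le_eq mult_ac)
qed

text \<open>
A minimum principle: by superharmonicity, if a pair of nonadjacent distinct vertices carries the
off-diagonal minimum, then so does every pair obtained by moving one vertex to a neighbour. Moving
the first vertex along a path to the second one, the minimum is carried to an edge.
\<close>

lemma balanced_minimum_on_edge:
  fixes a :: "'v \<times> 'v \<Rightarrow> real"
  assumes bal: "balanced (verts G \<times> verts G) (pair_kernel G) (real (card (verts G))) a"
    and nonneg: "\<And>v. v \<in> verts G \<Longrightarrow> 0 \<le> a (v, v)"
  obtains u v where "u \<rightarrow>\<^bsub>G\<^esub> v"
    and "\<And>x y. x \<in> verts G \<Longrightarrow> y \<in> verts G \<Longrightarrow> x \<noteq> y \<Longrightarrow> a (u, v) \<le> a (x, y)"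
proof -
  define D where "D = {(x, y). x \<in> verts G \<and> y \<in> verts G \<and> x \<noteq> y}"
  define m where "m = Min (a ` D)"
  have fin: "finite D"
    by (rule finite_subset[of _ "verts G \<times> verts G"]) (auto simp: D_def)
  obtain v0 where "v0 \<in> verts G" using two_vertices by (metis card.empty ex_in_conv not_numeral_le_zero)
  then obtain u0 where "v0 \<rightarrow>\<^bsub>G\<^esub> u0" using neighbour_exists by blast
  then have "(v0, u0) \<in> D" using adj_not_same by (auto simp: D_def dest: adj_in_verts)
  then have "m \<in> a ` D" unfolding m_def using fin by (intro Min_in) auto
  then obtain x0 y0 where xy0: "(x0, y0) \<in> D" "a (x0, y0) = m" by auto
  have m_le: "m \<le> a (x, y)" if "x \<in> verts G" "y \<in> verts G" "x \<noteq> y" for x y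
    unfolding m_def using fin that by (intro Min_le) (auto simp: D_def)
  have "\<exists>u v. u \<rightarrow>\<^bsub>G\<^esub> v \<and> a (u, v) = m"
    if "x \<rightarrow>\<^sup>*\<^bsub>G\<^esub> y" "x \<noteq> y" "y \<in> verts G" "a (x, y) = m" for x y
    using that
  proof (induction rule: converse_reachable_induct)
    case base
    then show ?case by simp
  next
    case (step x z)
    have x: "x \<in> verts G" and z: "z \<in> verts G" using adj_in_verts[OF step(1)] by auto
    note y = \<open>y \<in> verts G\<close>
    show ?case
    proof (cases "x \<rightarrow>\<^bsub>G\<^esub> y")
      case True
      then show ?thesis using \<open>a (x, y) = m\<close> by blast
    next
      case False
      then have False': "\<not> y \<rightarrow>\<^bsub>G\<^esub> x" using adjacent_sym by blast
      have zy: "z \<noteq> y" using False step(1) by auto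
      have zx: "z \<rightarrow>\<^bsub>G\<^esub> x" using step(1) adjacent_sym by blast
      have left: "m \<le> a (v, y)" if "v \<rightarrow>\<^bsub>G\<^esub> x" for v
        using that False' y adj_in_verts[OF that] by (intro m_le) auto
      have right: "m \<le> a (x, v)" if "v \<rightarrow>\<^bsub>G\<^esub> y" for v
        using that False x adj_in_verts[OF that] by (intro m_le) auto
      have "(\<Sum>v | v \<rightarrow>\<^bsub>G\<^esub> x. a (v, y)) + (\<Sum>v | v \<rightarrow>\<^bsub>G\<^esub> y. a (x, v)) \<le> 2 * real \<rho> * m"
        using balanced_nonadjacent_superharmonic[OF bal nonneg x y \<open>x \<noteq> y\<close> False] \<open>a (x, y) = m\<close> by simp
      moreover have "real \<rho> * m \<le> (\<Sum>v | v \<rightarrow>\<^bsub>G\<^esub> y. a (x, v))"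
        using sum_mono[of "{v. v \<rightarrow>\<^bsub>G\<^esub> y}" "\<lambda>_. m" "\<lambda>v. a (x, v)"] right card_in_neighbours[OF y] by simp
      \<comment> \<open>an average that is at most the minimum consists of minimal terms only\<close>
      ultimately have "(\<Sum>v | v \<rightarrow>\<^bsub>G\<^esub> x. a (v, y)) \<le> real \<rho> * m" by simp
      then have "(\<Sum>v | v \<rightarrow>\<^bsub>G\<^esub> x. a (v, y) - m) \<le> 0"
        using card_in_neighbours[OF x] by (simp add: sum_subtractf)
      moreover have "a (z, y) - m \<le> (\<Sum>v | v \<rightarrow>\<^bsub>G\<^esub> x. a (v, y) - m)"
        using zx left by (intro member_le_sum[where f = "\<lambda>v. a (v, y) - m"] finite_in_neighbours) auto
      ultimately have "a (z, y) = m" using left[OF zx] by simp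
      with step zy show ?thesis by blast
    qed
  qed
  moreover have "x0 \<rightarrow>\<^sup>*\<^bsub>G\<^esub> y0" "x0 \<noteq> y0" "y0 \<in> verts G"
    using xy0(1) by (auto simp: D_def intro: reachable_all)
  ultimately obtain u v where "u \<rightarrow>\<^bsub>G\<^esub> v" "a (u, v) = m"
    using xy0(2) by blast
  then show ?thesis using m_le that by simp
qed

end

locale distance_transitive_graph = connected_regular_graph G \<rho>
  for G :: "('v, 'e) pre_digraph" and \<rho> +
  assumes distance_transitive: "distance_transitive G"
begin

lemma vertex_transitive:
  assumes "x \<in> verts G" "y \<in> verts G"
  obtains \<phi> where "graph_automorphism G \<phi>" "iso_verts \<phi> x = y"
  using distance_transitive[unfolded distance_transitive_def, rule_format, of x x y y] assms
  by (auto simp: graph_dist_self)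

lemma balanced_diagonal_const:
  fixes a :: "'v \<times> 'v \<Rightarrow> real"
  assumes "balanced (verts G \<times> verts G) (pair_kernel G) (real (card (verts G))) a"
    and "x \<in> verts G" "y \<in> verts G"
  shows "a (x, x) = a (y, y)"
  using vertex_transitive[OF assms(2,3)] balanced_automorphism_invariant[OF assms(1)] assms(2) by metis

lemma balanced_edge_const:
  fixes a :: "'v \<times> 'v \<Rightarrow> real"
  assumes "balanced (verts G \<times> verts G) (pair_kernel G) (real (card (verts G))) a"
    and "u \<rightarrow>\<^bsub>G\<^esub> v" "x \<rightarrow>\<^bsub>G\<^esub> y"
  shows "a (u, v) = a (x, y)"
proof -
  have mem: "u \<in> verts G" "v \<in> verts G" "x \<in> verts G" "y \<in> verts G"
    using assms(2,3) by (auto dest: adj_in_verts)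
  obtain \<phi> where "graph_automorphism G \<phi>" "iso_verts \<phi> u = x" "iso_verts \<phi> v = y"
    using distance_transitive[unfolded distance_transitive_def, rule_format, of u v x y] mem
      graph_dist_adjacent[OF assms(2)] graph_dist_adjacent[OF assms(3)] by auto
  then show ?thesis
    using balanced_automorphism_invariant[OF assms(1) _ mem(1,2)] by metis
qed

text \<open>
All row sums agree by vertex transitivity.
\<close>

lemma balanced_row_sum:
  fixes a :: "'v \<times> 'v \<Rightarrow> real"
  assumes bal: "balanced (verts G \<times> verts G) (pair_kernel G) (real (card (verts G))) a"
    and mass: "(\<Sum>p\<in>verts G \<times> verts G. a p) = (real (card (verts G)))\<^sup>2"
    and x: "x \<in> verts G"
  shows "(\<Sum>y\<in>verts G. a (x, y)) = real (card (verts G))"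
proof -
  have row: "(\<Sum>y\<in>verts G. a (z, y)) = (\<Sum>y\<in>verts G. a (x, y))" if z: "z \<in> verts G" for z
  proof -
    obtain \<phi> where \<phi>: "graph_automorphism G \<phi>" "iso_verts \<phi> x = z"
      using vertex_transitive[OF x z] by blast
    have "(\<Sum>y\<in>verts G. a (z, y)) = (\<Sum>y\<in>verts G. a (iso_verts \<phi> x, iso_verts \<phi> y))"
      unfolding \<phi>(2) by (rule sum.reindex_bij_betw[OF automorphism_bij_betw[OF \<phi>(1)], symmetric])
    also have "\<dots> = (\<Sum>y\<in>verts G. a (x, y))"
      using balanced_automorphism_invariant[OF bal \<phi>(1) x] by simp
    finally show ?thesis .
  qed
  have "(real (card (verts G)))\<^sup>2 = (\<Sum>z\<in>verts G. \<Sum>y\<in>verts G. a (z, y))"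
    unfolding mass[symmetric] by (simp add: sum.cartesian_product)
  also have "\<dots> = real (card (verts G)) * (\<Sum>y\<in>verts G. a (x, y))"
    using row by simp
  finally show ?thesis using two_vertices by (auto simp: power2_eq_square)
qed

text \<open>
Let \<open>b\<close> be the common value on the edges, \<open>r\<close> the degree and \<open>n\<close> the number of vertices. The balance
on the diagonal gives \<open>2 r b = (r - 1) a (x, x)\<close>. As \<open>b\<close> is the off-diagonal minimum, the row of \<open>x\<close>
gives \<open>a (x, x) + (n - 1) b \<le> n\<close>. Eliminating \<open>b\<close> leaves the stated bound.
\<close>

lemma balanced_diagonal_bound:
  fixes a :: "'v \<times> 'v \<Rightarrow> real"
  assumes bal: "balanced (verts G \<times> verts G) (pair_kernel G) (real (card (verts G))) a"
    and nonneg: "\<And>v. v \<in> verts G \<Longrightarrow> 0 \<le> a (v, v)"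
    and mass: "(\<Sum>p\<in>verts G \<times> verts G. a p) = (real (card (verts G)))\<^sup>2"
    and x: "x \<in> verts G"
  shows "a (x, x) - 1 \<le> (real \<rho> + 1) / (real \<rho> - 1 + 2 * real \<rho> / (real (card (verts G)) - 1))"
proof -
  define n where "n = real (card (verts G))"
  define r where "r = real \<rho>"
  have n: "n \<ge> 2" using two_vertices by (simp add: n_def)
  have r: "r \<ge> 1" using degree_pos by (simp add: r_def)
  obtain u v where uv: "u \<rightarrow>\<^bsub>G\<^esub> v"
    and min: "\<And>x y. x \<in> verts G \<Longrightarrow> y \<in> verts G \<Longrightarrow> x \<noteq> y \<Longrightarrow> a (u, v) \<le> a (x, y)"
    using balanced_minimum_on_edge[OF bal nonneg] by blast
  define b where "b = a (u, v)"
  have edge: "a (y, z) = b" if "y \<rightarrow>\<^bsub>G\<^esub> z" for y z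
    unfolding b_def by (rule balanced_edge_const[OF bal that uv])
  have "a (x, x) = (\<Sum>v | v \<rightarrow>\<^bsub>G\<^esub> x. a (v, x) / r + a (x, v) / r + a (v, v) / r\<^sup>2)"
    using balanced_diagonal[OF bal x] by (simp add: r_def)
  also have "\<dots> = (\<Sum>v | v \<rightarrow>\<^bsub>G\<^esub> x. b / r + b / r + a (x, x) / r\<^sup>2)"
  proof (intro sum.cong refl)
    fix v assume "v \<in> {v. v \<rightarrow>\<^bsub>G\<^esub> x}"
    then have vx: "v \<rightarrow>\<^bsub>G\<^esub> x" and xv: "x \<rightarrow>\<^bsub>G\<^esub> v" using adjacent_sym by auto
    have "a (v, v) = a (x, x)"
      using balanced_diagonal_const[OF bal _ x] adj_in_verts[OF vx] by blast
    then show "a (v, x) / r + a (x, v) / r + a (v, v) / r\<^sup>2 = b / r + b / r + a (x, x) / r\<^sup>2"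
      using edge[OF vx] edge[OF xv] by simp
  qed
  also have "\<dots> = r * (b / r + b / r + a (x, x) / r\<^sup>2)"
    by (simp only: sum_constant card_in_neighbours[OF x] r_def)
  finally have "r * a (x, x) = r * (r * (b / r + b / r + a (x, x) / r\<^sup>2))" by simp
  also have "\<dots> = 2 * r * b + a (x, x)" using r by (simp add: field_simps power2_eq_square)
  finally have b: "2 * r * b = (r - 1) * a (x, x)" by (simp add: algebra_simps)
  have "(n - 1) * b = (\<Sum>y\<in>verts G - {x}. b)"
    using x n by (simp add: n_def card_Diff_singleton)
  also have "\<dots> \<le> (\<Sum>y\<in>verts G - {x}. a (x, y))"
    using x min by (intro sum_mono) (auto simp: b_def)
  also have "a (x, x) + \<dots> = n"
    using balanced_row_sum[OF bal mass x] x by (simp add: sum.remove[of _ x] n_def)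
  finally have "a (x, x) + (n - 1) * b \<le> n" by simp
  then have "2 * r * (a (x, x) + (n - 1) * b) \<le> 2 * r * n"
    using r by (intro mult_left_mono) auto
  moreover have "2 * r * (a (x, x) + (n - 1) * b) = a (x, x) * ((r - 1) * (n - 1) + 2 * r)"
    using b by algebra
  ultimately have main: "a (x, x) * ((r - 1) * (n - 1) + 2 * r) \<le> 2 * r * n" by simp
  have "(r - 1) * (n - 1) \<ge> 0" using r n by (intro mult_nonneg_nonneg) auto
  then have pos: "(r - 1) * (n - 1) + 2 * r > 0" using r by linarith
  have "(a (x, x) - 1) * ((r - 1) * (n - 1) + 2 * r) \<le> (r + 1) * (n - 1)"
    using main by (simp add: algebra_simps)
  then have "a (x, x) - 1 \<le> (r + 1) * (n - 1) / ((r - 1) * (n - 1) + 2 * r)"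
    using pos by (simp add: pos_le_divide_eq)
  also have "\<dots> = (r + 1) / (r - 1 + 2 * r / (n - 1))"
    using n by (simp add: divide_simps)
  finally show ?thesis by (simp add: r_def n_def)
qed

end

section \<open>Short-time expansion of the meteor process\<close>

definition counting_path :: "(real \<Rightarrow> nat) \<Rightarrow> bool" where
  "counting_path f \<longleftrightarrow> f 0 = 0 \<and> (\<forall>s t. 0 \<le> s \<longrightarrow> s \<le> t \<longrightarrow> f s \<le> f t) \<and>
     (\<forall>t\<ge>0. (f \<longlongrightarrow> f t) (at_right t))"

lemma counting_path_no_jump:
  assumes "counting_path f" "f h = 0" "t \<le> h"
  shows "\<not> jump_time f t"
proof
  assume "jump_time f t"
  then have "0 < t" "f 0 < f t" unfolding jump_time_def by auto
  moreover have "f t \<le> f h"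
    using assms(1)[unfolded counting_path_def] \<open>0 < t\<close> assms(3) by (metis less_imp_le)
  ultimately show False using assms by simp
qed

text \<open>
The jump is at the infimum of the times where the path has reached 1, and right-continuity makes
the path reach 1 at that infimum.
\<close>

lemma counting_path_one_jump:
  assumes f: "counting_path f" and h: "f h = 1" "0 < h"
  obtains u where "0 < u" "u \<le> h" "jump_time f u" "\<And>t. t \<le> h \<Longrightarrow> jump_time f t \<Longrightarrow> t = u"
proof -
  have f0: "f 0 = 0" and mono: "\<And>s t. 0 \<le> s \<Longrightarrow> s \<le> t \<Longrightarrow> f s \<le> f t"
    and rc: "\<And>t. 0 \<le> t \<Longrightarrow> (f \<longlongrightarrow> f t) (at_right t)"
    using f by (auto simp: counting_path_def)
  define S where "S = {t. 0 \<le> t \<and> t \<le> h \<and> 1 \<le> f t}"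
  define u where "u = Inf S"
  have "h \<in> S" using h by (simp add: S_def)
  have bdd: "bdd_below S" by (intro bdd_belowI[of _ 0]) (simp add: S_def)
  have "0 \<le> u" unfolding u_def using \<open>h \<in> S\<close> by (intro cInf_greatest) (auto simp: S_def)
  have "u \<le> h" unfolding u_def using \<open>h \<in> S\<close> bdd by (rule cInf_lower)
  have fu: "f u = 1"
  proof (rule ccontr)
    assume "f u \<noteq> 1"
    moreover have "f u \<le> 1" using mono[OF \<open>0 \<le> u\<close> \<open>u \<le> h\<close>] h by simp
    ultimately have "f u = 0" by simp
    then have "eventually (\<lambda>s. f s = 0) (at_right u)"
      using rc[OF \<open>0 \<le> u\<close>] by (simp add: tendsto_discrete)
    then obtain b where "u < b" and b: "\<And>s. u < s \<Longrightarrow> s < b \<Longrightarrow> f s = 0"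
      unfolding eventually_at_right_field by blast
    then obtain t where "t \<in> S" "t < b"
      using cInf_lessD[of S b] \<open>h \<in> S\<close> unfolding u_def by blast
    moreover have "u \<le> t" unfolding u_def using \<open>t \<in> S\<close> bdd by (rule cInf_lower)
    moreover have "t \<noteq> u" using \<open>t \<in> S\<close> \<open>f u = 0\<close> by (auto simp: S_def)
    ultimately show False using b[of t] by (simp add: S_def)
  qed
  have before: "f s = 0" if "0 \<le> s" "s < u" for s
  proof (rule ccontr)
    assume "f s \<noteq> 0"
    then have "s \<in> S" using that \<open>u \<le> h\<close> by (simp add: S_def)
    then have "u \<le> s" unfolding u_def using bdd by (rule cInf_lower)
    with that show False by simp
  qed
  have "0 < u" using fu f0 \<open>0 \<le> u\<close> by (cases "u = 0") auto
  have "jump_time f u" unfolding jump_time_def using \<open>0 < u\<close> before fu by simp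
  have "t = u" if "t \<le> h" "jump_time f t" for t
  proof -
    have t: "0 < t" "\<And>s. 0 \<le> s \<Longrightarrow> s < t \<Longrightarrow> f s < f t" using that by (auto simp: jump_time_def)
    have "f t \<le> 1" using mono[of t h] t(1) that(1) h by simp
    have "\<not> u < t" using t(2)[of u] fu \<open>f t \<le> 1\<close> \<open>0 \<le> u\<close> by auto
    moreover have "\<not> t < u" using before[of t] t(2)[of 0] t(1) f0 by auto
    ultimately show "t = u" by simp
  qed
  with \<open>0 < u\<close> \<open>u \<le> h\<close> \<open>jump_time f u\<close> show ?thesis by (rule that)
qed

text \<open>
Passes from independence of \<open>\<sigma>\<close>-algebras to independence of real random variables, for which the
product rule for expectations is available.
\<close>

lemma (in prob_space) indep_set_imp_indep_var:
  fixes X Y :: "'a \<Rightarrow> real"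
  assumes indep: "indep_set (sets F) (sets F')" and space: "space F = space M" "space F' = space M"
    and X: "X \<in> borel_measurable F" and Y: "Y \<in> borel_measurable F'"
  shows "indep_var borel X borel Y"
proof -
  have sub: "sets F \<subseteq> events" "sets F' \<subseteq> events"
    using indep_setD_ev1[OF indep] indep_setD_ev2[OF indep] by auto
  have rv: "random_variable borel X" "random_variable borel Y"
    using measurable_mono[of borel borel F M] measurable_mono[of borel borel F' M] sub space X Y by auto
  have "sigma_sets (space M) {X -` A \<inter> space M |A. A \<in> sets borel} \<subseteq> sets F"
    unfolding space(1)[symmetric] using measurable_sets[OF X] by (intro sets.sigma_sets_subset) auto
  moreover have "sigma_sets (space M) {Y -` A \<inter> space M |A. A \<in> sets borel} \<subseteq> sets F'"
    unfolding space(2)[symmetric] using measurable_sets[OF Y] by (intro sets.sigma_sets_subset) auto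
  ultimately have "indep_set (sigma_sets (space M) {X -` A \<inter> space M |A. A \<in> sets borel})
      (sigma_sets (space M) {Y -` A \<inter> space M |A. A \<in> sets borel})"
    using indep unfolding indep_sets2_eq by (meson order_trans subsetD)
  with rv show ?thesis by (simp add: indep_var_eq)
qed

context meteor_process
begin

lemma AE_counting_path: "AE \<omega> in P. \<forall>v\<in>verts G. counting_path (\<lambda>t. N v t \<omega>)"
proof (rule AE_finite_allI[OF finite_verts])
  fix v assume "v \<in> verts G"
  then interpret poisson_process P 1 "N v" by (rule poisson_clocks)
  show "AE \<omega> in P. counting_path (\<lambda>t. N v t \<omega>)"
    using count_start count_mono count_right_continuous
    by eventually_elim (auto simp: counting_path_def)
qed

lemma AE_no_hit:
  assumes "0 < h"
  shows "AE \<omega> in P. (\<forall>v\<in>verts G. N v h \<omega> = 0) \<longrightarrow> M h \<omega> = M 0 \<omega>"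
  using AE_counting_path constant_between
proof eventually_elim
  case (elim \<omega>)
  show ?case
  proof
    assume "\<forall>v\<in>verts G. N v h \<omega> = 0"
    then show "M h \<omega> = M 0 \<omega>"
      using elim(2)[rule_format, of 0 h] counting_path_no_jump[of "\<lambda>t. N _ t \<omega>" h] elim(1) assms
      by (metis less_imp_le order_refl)
  qed
qed

text \<open>
The masses are constant before and after the only jump, so the left limits at the jump are the
initial masses.
\<close>

lemma AE_single_hit:
  assumes h: "0 < h" and v: "v \<in> verts G"
  shows "AE \<omega> in P. (\<forall>w\<in>verts G. N w h \<omega> = (if w = v then 1 else 0))
    \<longrightarrow> M h \<omega> = meteor_hit G v (M 0 \<omega>)"
  using AE_counting_path constant_between hit
proof eventually_elim
  case (elim \<omega>)
  show ?case
  proof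
    assume count: "\<forall>w\<in>verts G. N w h \<omega> = (if w = v then 1 else 0)"
    have path: "counting_path (\<lambda>t. N w t \<omega>)" if "w \<in> verts G" for w
      using elim(1) that by blast
    have "N v h \<omega> = 1" using count v by simp
    then obtain u where u: "0 < u" "u \<le> h" "jump_time (\<lambda>t. N v t \<omega>) u"
      and uniq: "\<And>t. t \<le> h \<Longrightarrow> jump_time (\<lambda>t. N v t \<omega>) t \<Longrightarrow> t = u"
      using counting_path_one_jump[OF path[OF v] _ h] by blast
    have jump: "w = v \<and> t = u" if "w \<in> verts G" "t \<le> h" "jump_time (\<lambda>r. N w r \<omega>) t" for w t
    proof (cases "w = v")
      case True
      with uniq[OF that(2)] that(3) show ?thesis by simp
    next
      case False
      then have "N w h \<omega> = 0" using count that(1) by simp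
      from counting_path_no_jump[OF path[OF that(1)] this that(2)] that(3) show ?thesis by simp
    qed
    \<comment> \<open>no clock rings strictly before \<open>u\<close> or in the interval from \<open>u\<close> to \<open>h\<close>\<close>
    have "M s \<omega> = M 0 \<omega>" if "0 < s" "s < u" for s
    proof (rule elim(2)[rule_format], intro conjI ballI allI impI notI)
      fix w t assume "w \<in> verts G" "0 < t \<and> t \<le> s" "jump_time (\<lambda>r. N w r \<omega>) t"
      then show False using jump[of w t] that u(2) by auto
    qed (use that in auto)
    then have "Lim (at_left u) (\<lambda>s. M s \<omega> x) = M 0 \<omega> x" for x
      using u(1) by (intro tendsto_Lim tendsto_eventually eventually_at_leftI[of 0]) auto
    then have "M u \<omega> = meteor_hit G v (M 0 \<omega>)"
      using elim(3)[rule_format, OF v u(3)] by simp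
    moreover have "M h \<omega> = M u \<omega>"
    proof (rule elim(2)[rule_format], intro conjI ballI allI impI notI)
      fix w t assume "w \<in> verts G" "u < t \<and> t \<le> h" "jump_time (\<lambda>r. N w r \<omega>) t"
      then show False using jump[of w t] by auto
    qed (use u in auto)
    ultimately show "M h \<omega> = meteor_hit G v (M 0 \<omega>)" by simp
  qed
qed

definition clock_event :: "real \<Rightarrow> ('v \<Rightarrow> nat) \<Rightarrow> 'w set" where
  "clock_event h k = {\<omega>\<in>space P. \<forall>w\<in>verts G. N w h \<omega> = k w}"

lemma indep_counts:
  assumes "0 \<le> h"
  shows "indep_vars (\<lambda>_. count_space UNIV) (\<lambda>v \<omega>. N v h \<omega>) (verts G)"
proof -
  have "indep_vars (\<lambda>_. count_space UNIV) (\<lambda>v \<omega>. (\<lambda>t\<in>{0..}. N v t \<omega>) h) (verts G)"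
    using assms unfolding path_space_def[symmetric]
    by (intro indep_vars_compose2[OF indep_clocks, where Y = "\<lambda>_ p. p h"])
       (auto simp: path_space_def intro!: measurable_component_singleton)
  then show ?thesis using assms by simp
qed

lemma prob_count:
  assumes "0 < h" "v \<in> verts G"
  shows "prob {\<omega>\<in>space P. N v h \<omega> = k} = h ^ k / fact k * exp (- h)"
proof -
  interpret c: poisson_process P 1 "N v" using assms(2) by (rule poisson_clocks)
  have rv[measurable]: "random_variable (count_space UNIV) (N v h)" "random_variable (count_space UNIV) (N v 0)"
    using assms(1) c.count_measurable by auto
  have "prob {\<omega>\<in>space P. N v h \<omega> = k} = prob {\<omega>\<in>space P. N v h \<omega> - N v 0 \<omega> = k}"
  proof (rule finite_measure_eq_AE)
    show "AE \<omega> in P. (\<omega> \<in> {\<omega>\<in>space P. N v h \<omega> = k}) = (\<omega> \<in> {\<omega>\<in>space P. N v h \<omega> - N v 0 \<omega> = k})"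
      using c.count_start by eventually_elim simp
  qed measurable
  also have "\<dots> = measure (distr P (count_space UNIV) (\<lambda>\<omega>. N v h \<omega> - N v 0 \<omega>)) {k}"
    by (subst measure_distr) (auto intro!: arg_cong[where f = prob])
  also have "\<dots> = pmf (poisson_pmf h) k"
    using c.poisson_increments[of 0 h] assms(1) by (simp add: measure_pmf_single)
  finally show ?thesis using assms(1) by simp
qed

lemma prob_clock_event:
  assumes "0 < h" "verts G \<noteq> {}"
  shows "prob (clock_event h k) = (\<Prod>v\<in>verts G. h ^ k v / fact (k v) * exp (- h))"
proof -
  have "clock_event h k = (\<Inter>v\<in>verts G. N v h -` {k v} \<inter> space P)"
    using assms(2) by (auto simp: clock_event_def)
  also have "prob \<dots> = (\<Prod>v\<in>verts G. prob (N v h -` {k v} \<inter> space P))"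
    using assms by (intro indep_varsD[OF indep_counts]) auto
  also have "\<dots> = (\<Prod>v\<in>verts G. prob {\<omega>\<in>space P. N v h \<omega> = k v})"
    by (intro prod.cong refl arg_cong[where f = prob]) auto
  finally show ?thesis using assms(1) by (simp add: prob_count)
qed

text \<open>
Whether the clocks show the counts \<open>k\<close> at time \<open>h\<close> is decided by the \<open>\<sigma>\<close>-algebra of the clocks, which
is independent of the initial configuration.
\<close>

lemma initial_indep_clock_event:
  assumes h: "0 \<le> h" and g: "g \<in> borel_measurable (config_space G)"
    and int: "integrable P (\<lambda>\<omega>. g (M 0 \<omega>))"
  shows "expectation (\<lambda>\<omega>. g (M 0 \<omega>) * indicator (clock_event h k) \<omega>)
      = expectation (\<lambda>\<omega>. g (M 0 \<omega>)) * prob (clock_event h k)" (is ?eq)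
    and "clock_event h k \<in> events"
proof -
  define paths where "paths = (\<Pi>\<^sub>M v\<in>verts G. path_space)"
  define clocks where "clocks = (\<lambda>\<omega>. \<lambda>v\<in>verts G. \<lambda>t\<in>{0..}. N v t \<omega>)"
  define F where "F = vimage_algebra (space P) (M 0) (config_space G)"
  define F' where "F' = vimage_algebra (space P) clocks paths"
  have indep: "indep_set (sets F) (sets F')"
    using indep_initial by (simp add: F_def F'_def clocks_def paths_def)
  have M0: "M 0 \<in> space P \<rightarrow> space (config_space G)"
    using mass_measurable[of 0] by (auto dest: measurable_space)
  have X: "(\<lambda>\<omega>. g (M 0 \<omega>)) \<in> borel_measurable F"
    using measurable_compose[OF measurable_vimage_algebra1[OF M0] g] by (simp add: F_def)
  have clocks_space: "clocks \<in> space P \<rightarrow> space paths"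
    by (auto simp: clocks_def paths_def path_space_def space_PiM)
  have comp: "(\<lambda>q. q w h) \<in> measurable paths (count_space UNIV)" if "w \<in> verts G" for w
  proof -
    have "(\<lambda>q. q w) \<in> measurable paths path_space"
      unfolding paths_def using that by (rule measurable_component_singleton)
    moreover have "(\<lambda>p. p h) \<in> measurable path_space (count_space UNIV)"
      unfolding path_space_def using h by (intro measurable_component_singleton) simp
    ultimately show ?thesis by (rule measurable_compose)
  qed
  have "{q\<in>space paths. \<forall>w\<in>verts G. q w h = k w} \<in> sets paths"
    using measurable_sets[OF comp, of _ "{k _}"]
    by (intro sets.sets_Collect_finite_All finite_verts)
       (auto simp: vimage_def Int_def conj_commute)
  then have "clocks -` {q\<in>space paths. \<forall>w\<in>verts G. q w h = k w} \<inter> space P \<in> sets F'"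
    unfolding F'_def by (rule in_vimage_algebra)
  also have "clocks -` {q\<in>space paths. \<forall>w\<in>verts G. q w h = k w} \<inter> space P = clock_event h k"
    using clocks_space h by (auto simp: clock_event_def clocks_def)
  finally have ev: "clock_event h k \<in> sets F'" .
  then show "clock_event h k \<in> events" using indep_setD_ev2[OF indep] by auto
  have "indep_var borel (\<lambda>\<omega>. g (M 0 \<omega>)) borel (indicator (clock_event h k) :: 'w \<Rightarrow> real)"
    using ev X by (intro indep_set_imp_indep_var[OF indep]) (auto simp: F_def F'_def)
  from indep_var_lebesgue_integral[OF this int] \<open>clock_event h k \<in> events\<close> show ?eq
    by (simp add: integrable_indicator_iff emeasure_eq_measure)
qed

lemma measurable_meteor_hit: "meteor_hit G v \<in> measurable (config_space G) (config_space G)"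
  unfolding meteor_hit_def config_space_def
proof (rule measurable_restrict)
  fix x assume x: "x \<in> verts G"
  have c: "(\<lambda>m. m w) \<in> borel_measurable (\<Pi>\<^sub>M v\<in>verts G. borel :: real measure)" if "w \<in> verts G" for w
    using that by (rule measurable_component_singleton)
  show "(\<lambda>m. if x = v then 0 else if v \<rightarrow>\<^bsub>G\<^esub> x then m x + m v / real (out_degree G v) else m x)
      \<in> borel_measurable (\<Pi>\<^sub>M v\<in>verts G. borel :: real measure)"
  proof (cases "v \<rightarrow>\<^bsub>G\<^esub> x")
    case True
    then show ?thesis using c[OF x] c[OF adj_in_verts(1)[OF True]] by (cases "x = v") auto
  next
    case False
    then show ?thesis using c[OF x] by (cases "x = v") auto
  qed
qed

text \<open>
Up to time \<open>h\<close> there is no ring, with probability \<open>exp (- n h)\<close>, or a single ring at \<open>v\<close>, with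
probability \<open>h exp (- n h)\<close> for each \<open>v\<close>; in these cases the configuration at time \<open>h\<close> is known. In the
remaining case \<open>f\<close> contributes at most \<open>C\<close>, which gives the error term.
\<close>

lemma short_time_expansion:
  assumes h: "0 < h" and f[measurable]: "f \<in> borel_measurable (config_space G)"
    and "verts G \<noteq> {}"
    and bdh: "AE \<omega> in P. \<bar>f (M h \<omega>)\<bar> \<le> C" and bd0: "AE \<omega> in P. \<bar>f (M 0 \<omega>)\<bar> \<le> C"
    and bdhit: "\<And>v. v \<in> verts G \<Longrightarrow> AE \<omega> in P. \<bar>f (meteor_hit G v (M 0 \<omega>))\<bar> \<le> C"
  defines "n \<equiv> real (card (verts G))"
  shows "\<bar>expectation (\<lambda>\<omega>. f (M h \<omega>)) - expectation (\<lambda>\<omega>. f (M 0 \<omega>)) * exp (- n * h)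
      - (\<Sum>v\<in>verts G. expectation (\<lambda>\<omega>. f (meteor_hit G v (M 0 \<omega>)))) * (h * exp (- n * h))\<bar>
    \<le> C * (1 - exp (- n * h) - n * (h * exp (- n * h)))"
proof -
  have Mm[measurable]: "M h \<in> measurable P (config_space G)" "M 0 \<in> measurable P (config_space G)"
    using mass_measurable h by auto
  let ?A = "\<lambda>v. clock_event h (\<lambda>w. if w = v then 1 else 0)" and ?Z = "clock_event h (\<lambda>_. 0)"
  have int_h: "integrable P (\<lambda>\<omega>. f (M h \<omega>))" and int_0: "integrable P (\<lambda>\<omega>. f (M 0 \<omega>))"
    using bdh bd0 by (auto intro!: integrable_const_bound[where B = C])
  have fhit: "(\<lambda>m. f (meteor_hit G v m)) \<in> borel_measurable (config_space G)" for v
    by (rule measurable_compose[OF measurable_meteor_hit f])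
  have int_hit: "integrable P (\<lambda>\<omega>. f (meteor_hit G v (M 0 \<omega>)))" if "v \<in> verts G" for v
    using bdhit[OF that] measurable_compose[OF Mm(2) fhit] by (auto intro!: integrable_const_bound[where B = C])
  have ev[measurable]: "clock_event h k \<in> events" for k
    using h by (intro initial_indep_clock_event(2)[OF _ f int_0]) simp
  have p0: "prob ?Z = exp (- n * h)"
    using h assms(3) by (simp add: prob_clock_event n_def exp_of_nat_mult[symmetric] mult_ac)
  have p1: "prob (?A v) = h * exp (- n * h)" if v: "v \<in> verts G" for v
  proof -
    have "prob (?A v) = (\<Prod>w\<in>verts G. (if w = v then h else 1) * exp (- h))"
      unfolding prob_clock_event[OF h assms(3)] by (intro prod.cong) auto
    also have "\<dots> = h * exp (- n * h)"
      using v by (simp add: prod.distrib n_def exp_of_nat_mult[symmetric] mult_ac)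
    finally show ?thesis .
  qed
  \<comment> \<open>\<open>R\<close> is the error of the expansion on a path, and \<open>E\<close> equals \<open>C\<close> on the event of two or more rings and 0 elsewhere\<close>
  define T0 where "T0 \<omega> = f (M 0 \<omega>) * indicator ?Z \<omega>" for \<omega>
  define T where "T v \<omega> = f (meteor_hit G v (M 0 \<omega>)) * indicator (?A v) \<omega>" for v \<omega>
  define I0 where "I0 = (indicator ?Z :: 'w \<Rightarrow> real)"
  define I where "I v = (indicator (?A v) :: 'w \<Rightarrow> real)" for v
  define R where "R \<omega> = f (M h \<omega>) - T0 \<omega> - (\<Sum>v\<in>verts G. T v \<omega>)" for \<omega>
  define E where "E \<omega> = C * (1 - I0 \<omega> - (\<Sum>v\<in>verts G. I v \<omega>))" for \<omega>
  have int_T0: "integrable P T0"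
    unfolding T0_def using int_0 by (intro integrable_real_mult_indicator) auto
  have int_T: "integrable P (T v)" if "v \<in> verts G" for v
    unfolding T_def using int_hit[OF that] by (intro integrable_real_mult_indicator) auto
  have int_I: "integrable P I0" "integrable P (I v)" for v
    unfolding I0_def I_def by (simp_all add: integrable_indicator_iff emeasure_eq_measure)
  have ET0: "expectation T0 = expectation (\<lambda>\<omega>. f (M 0 \<omega>)) * exp (- n * h)"
    unfolding T0_def p0[symmetric] using h by (intro initial_indep_clock_event(1)[OF _ f int_0]) simp
  have ET: "expectation (T v) = expectation (\<lambda>\<omega>. f (meteor_hit G v (M 0 \<omega>))) * (h * exp (- n * h))"
    if "v \<in> verts G" for v
    unfolding T_def p1[OF that, symmetric]
    using h by (intro initial_indep_clock_event(1)[OF _ fhit int_hit[OF that]]) simp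
  have "expectation R = expectation (\<lambda>\<omega>. f (M h \<omega>)) - expectation T0 - (\<Sum>v\<in>verts G. expectation (T v))"
    unfolding R_def using int_h int_T0 int_T
    by (simp add: Bochner_Integration.integral_sum)
  then have ER: "expectation R = expectation (\<lambda>\<omega>. f (M h \<omega>)) - expectation (\<lambda>\<omega>. f (M 0 \<omega>)) * exp (- n * h)
      - (\<Sum>v\<in>verts G. expectation (\<lambda>\<omega>. f (meteor_hit G v (M 0 \<omega>)))) * (h * exp (- n * h))"
    by (simp add: ET0 ET sum_distrib_right)
  have "expectation E = C * (1 - expectation I0 - (\<Sum>v\<in>verts G. expectation (I v)))"
    unfolding E_def using int_I by (simp add: Bochner_Integration.integral_sum prob_space)
  also have "\<dots> = C * (1 - exp (- n * h) - n * (h * exp (- n * h)))"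
    unfolding I0_def I_def by (simp add: p0 p1 n_def)
  finally have EE: "expectation E = C * (1 - exp (- n * h) - n * (h * exp (- n * h)))" .
  have "AE \<omega> in P. \<forall>v\<in>verts G. (\<forall>w\<in>verts G. N w h \<omega> = (if w = v then 1 else 0))
      \<longrightarrow> M h \<omega> = meteor_hit G v (M 0 \<omega>)"
    using AE_single_hit[OF h] by (intro AE_finite_allI finite_verts) auto
  then have "AE \<omega> in P. \<bar>R \<omega>\<bar> \<le> E \<omega>"
    using AE_no_hit[OF h] bdh
  proof eventually_elim
    case (elim \<omega>)
    consider "\<omega> \<in> ?Z" | v where "v \<in> verts G" "\<omega> \<in> ?A v"
      | "\<omega> \<notin> ?Z" "\<And>v. v \<in> verts G \<Longrightarrow> \<omega> \<notin> ?A v" by blast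
    then show ?case
    proof cases
      case 1
      then have "\<omega> \<notin> ?A v" if "v \<in> verts G" for v using that by (auto simp: clock_event_def)
      then have "T v \<omega> = 0" "I v \<omega> = 0" if "v \<in> verts G" for v
        using that by (auto simp: T_def I_def)
      moreover have "M h \<omega> = M 0 \<omega>" using 1 elim(2) by (simp add: clock_event_def)
      ultimately show ?thesis using 1 by (simp add: R_def E_def T0_def I0_def)
    next
      case (2 v)
      then have "\<omega> \<notin> ?Z" by (auto simp: clock_event_def)
      then have zero: "T0 \<omega> = 0" "I0 \<omega> = 0" by (auto simp: T0_def I0_def)
      have hit: "M h \<omega> = meteor_hit G v (M 0 \<omega>)"
        using 2 elim(1) by (simp add: clock_event_def)
      have only: "\<omega> \<in> ?A w \<longleftrightarrow> w = v" if "w \<in> verts G" for w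
        using 2 that by (auto simp: clock_event_def split: if_splits)
      have "T w \<omega> = (if w = v then f (M h \<omega>) else 0)" "I w \<omega> = (if w = v then 1 else 0)"
        if "w \<in> verts G" for w
        using only[OF that] hit by (auto simp: T_def I_def)
      then have "(\<Sum>w\<in>verts G. T w \<omega>) = f (M h \<omega>)" "(\<Sum>w\<in>verts G. I w \<omega>) = 1"
        using 2(1) by simp_all
      then show ?thesis using zero by (simp add: R_def E_def)
    next
      case 3
      then have "T v \<omega> = 0" "I v \<omega> = 0" if "v \<in> verts G" for v
        using that by (auto simp: T_def I_def)
      then show ?thesis using 3 elim(3) by (simp add: R_def E_def T0_def I0_def)
    qed
  qed
  moreover have "integrable P R"
    unfolding R_def using int_h int_T0 int_T
    by (intro Bochner_Integration.integrable_diff Bochner_Integration.integrable_sum) auto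
  moreover have "integrable P E"
    unfolding E_def using int_I
    by (intro integrable_mult_right Bochner_Integration.integrable_diff Bochner_Integration.integrable_sum) auto
  ultimately have "\<bar>expectation R\<bar> \<le> expectation E"
    by (intro order_trans[OF integral_abs_bound] integral_mono_AE) auto
  then show ?thesis unfolding ER EE .
qed

text \<open>
The generator maps \<open>f\<close> to the sum over \<open>v\<close> of \<open>f (meteor_hit G v m) - f m\<close>, and its mean under a
stationary law is 0. This is the short-time expansion divided by \<open>h\<close>, in the limit \<open>h \<rightarrow> 0\<close>: the error
term is of order \<open>h\<^sup>2\<close>.
\<close>

lemma stationary_generator:
  assumes f: "f \<in> borel_measurable (config_space G)" and "verts G \<noteq> {}"
    and stat: "\<And>h. 0 < h \<Longrightarrow> expectation (\<lambda>\<omega>. f (M h \<omega>)) = expectation (\<lambda>\<omega>. f (M 0 \<omega>))"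
    and bd: "\<And>h. 0 \<le> h \<Longrightarrow> AE \<omega> in P. \<bar>f (M h \<omega>)\<bar> \<le> C"
    and bdhit: "\<And>v. v \<in> verts G \<Longrightarrow> AE \<omega> in P. \<bar>f (meteor_hit G v (M 0 \<omega>))\<bar> \<le> C"
  shows "(\<Sum>v\<in>verts G. expectation (\<lambda>\<omega>. f (meteor_hit G v (M 0 \<omega>))))
    = real (card (verts G)) * expectation (\<lambda>\<omega>. f (M 0 \<omega>))"
proof -
  define n where "n = real (card (verts G))"
  define F where "F = expectation (\<lambda>\<omega>. f (M 0 \<omega>))"
  define S where "S = (\<Sum>v\<in>verts G. expectation (\<lambda>\<omega>. f (meteor_hit G v (M 0 \<omega>))))"
  have "n > 0" using assms(2) by (simp add: n_def card_gt_0_iff)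
  have le: "\<bar>F * ((1 - exp (- n * h)) / h) - S * exp (- n * h)\<bar>
      \<le> C * ((1 - exp (- n * h)) / h - n * exp (- n * h))" if h: "0 < h" for h
  proof -
    have "\<bar>F - F * exp (- n * h) - S * (h * exp (- n * h))\<bar> \<le> C * (1 - exp (- n * h) - n * (h * exp (- n * h)))"
      using short_time_expansion[OF h f assms(2) bd bd bdhit] stat[OF h] h
      by (simp add: n_def F_def S_def)
    then have "\<bar>F - F * exp (- n * h) - S * (h * exp (- n * h))\<bar> / h
        \<le> C * (1 - exp (- n * h) - n * (h * exp (- n * h))) / h"
      using h by (intro divide_right_mono) auto
    also have "\<bar>F - F * exp (- n * h) - S * (h * exp (- n * h))\<bar> / h
        = \<bar>(F - F * exp (- n * h) - S * (h * exp (- n * h))) / h\<bar>" using h by simp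
    also have "(F - F * exp (- n * h) - S * (h * exp (- n * h))) / h
        = F * ((1 - exp (- n * h)) / h) - S * exp (- n * h)" using h by (simp add: field_simps)
    also have "C * (1 - exp (- n * h) - n * (h * exp (- n * h))) / h
        = C * ((1 - exp (- n * h)) / h - n * exp (- n * h))" using h by (simp add: field_simps)
    finally show ?thesis .
  qed
  have lim: "((\<lambda>h. (1 - exp (- n * h)) / h) \<longlongrightarrow> n) (at_right 0)"
    and lim': "((\<lambda>h. exp (- n * h)) \<longlongrightarrow> 1) (at_right 0)"
    using \<open>n > 0\<close> by real_asymp+
  have "((\<lambda>h. \<bar>F * ((1 - exp (- n * h)) / h) - S * exp (- n * h)\<bar>) \<longlongrightarrow> \<bar>F * n - S * 1\<bar>) (at_right 0)"
    by (intro tendsto_intros lim lim')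
  moreover have "((\<lambda>h. C * ((1 - exp (- n * h)) / h - n * exp (- n * h))) \<longlongrightarrow> C * (n - n * 1)) (at_right 0)"
    by (intro tendsto_intros lim lim')
  ultimately have "\<bar>F * n - S * 1\<bar> \<le> C * (n - n * 1)"
    using le by (intro tendsto_le[OF trivial_limit_at_right_real])
      (auto intro!: eventually_at_rightI[of 0 1])
  then show ?thesis by (simp add: F_def S_def n_def mult.commute)
qed

end

section \<open>The variance bound\<close>

definition unit_mean_configs :: "('v, 'e) pre_digraph \<Rightarrow> ('v \<Rightarrow> real) set" where
  "unit_mean_configs G = {m. (\<forall>v\<in>verts G. 0 \<le> m v) \<and> (\<Sum>v\<in>verts G. m v) = real (card (verts G))}"

lemma (in connected_regular_graph) meteor_hit_unit_mean_configs:
  assumes "m \<in> unit_mean_configs G" "v \<in> verts G"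
  shows "meteor_hit G v m \<in> unit_mean_configs G"
  using assms sum_meteor_hit[OF assms(2), of m]
  by (auto simp: unit_mean_configs_def meteor_hit_def)

lemma (in connected_regular_graph) unit_mean_config_le:
  assumes "m \<in> unit_mean_configs G" "v \<in> verts G"
  shows "m v \<le> real (card (verts G))"
  using assms member_le_sum[of v "verts G" m] by (auto simp: unit_mean_configs_def)

locale stationary_meteor_process = distance_transitive_graph G \<rho> + meteor_process G P N M
  for G :: "('v, 'e) pre_digraph" and \<rho> and P :: "'w measure" and N M +
  fixes Q
  assumes initial_mass: "AE \<omega> in P. (\<Sum>v\<in>verts G. M 0 \<omega> v) = real (card (verts G))"
    and stationary: "stationary_distribution G P M Q"
begin

lemma stationary_law: "0 \<le> h \<Longrightarrow> distr P (config_space G) (M h) = Q"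
  using stationary by (simp add: stationary_distribution_def)

lemma measurable_mass_at:
  "v \<in> verts G \<Longrightarrow> (\<lambda>m. m v) \<in> borel_measurable (config_space G)"
  unfolding config_space_def by (rule measurable_component_singleton)

text \<open>
Nonnegativity and total mass are known at time 0, and the configuration has the same law at all
times.
\<close>

lemma AE_unit_mean_configs:
  assumes "0 \<le> h"
  shows "AE \<omega> in P. M h \<omega> \<in> unit_mean_configs G"
proof -
  have [measurable]: "(\<lambda>m. m v) \<in> borel_measurable (config_space G)" if "v \<in> verts G" for v
    using that by (rule measurable_mass_at)
  have sets: "{m\<in>space (config_space G). m \<in> unit_mean_configs G} \<in> sets (config_space G)"
    unfolding unit_mean_configs_def by measurable
  have "AE \<omega> in P. M 0 \<omega> \<in> unit_mean_configs G"
    using initial_mass initial_nonneg by eventually_elim (simp add: unit_mean_configs_def)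
  then have "AE m in distr P (config_space G) (M 0). m \<in> unit_mean_configs G"
    by (simp add: AE_distr_iff[OF mass_measurable sets])
  also have "distr P (config_space G) (M 0) = distr P (config_space G) (M h)"
    using stationary_law assms by simp
  finally show ?thesis
    by (simp add: AE_distr_iff[OF mass_measurable[OF assms] sets])
qed

definition pair_moment :: "'v \<times> 'v \<Rightarrow> real" where
  "pair_moment p = expectation (\<lambda>\<omega>. M 0 \<omega> (fst p) * M 0 \<omega> (snd p))"

lemma mass_random_variable:
  "0 \<le> h \<Longrightarrow> v \<in> verts G \<Longrightarrow> (\<lambda>\<omega>. M h \<omega> v) \<in> borel_measurable P"
  by (rule measurable_compose[OF mass_measurable measurable_mass_at])

lemma abs_mass_product_le:
  assumes "m \<in> unit_mean_configs G" "x \<in> verts G" "y \<in> verts G"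
  shows "\<bar>m x * m y\<bar> \<le> (real (card (verts G)))\<^sup>2"
  using assms unit_mean_config_le[OF assms(1)] unfolding abs_mult power2_eq_square
  by (intro mult_mono) (auto simp: unit_mean_configs_def)

lemma integrable_mass_product:
  assumes "x \<in> verts G" "y \<in> verts G"
  shows "integrable P (\<lambda>\<omega>. M 0 \<omega> x * M 0 \<omega> y)"
proof (rule integrable_const_bound)
  show "AE \<omega> in P. norm (M 0 \<omega> x * M 0 \<omega> y) \<le> (real (card (verts G)))\<^sup>2"
    using AE_unit_mean_configs[OF order_refl]
    unfolding real_norm_def by eventually_elim (rule abs_mass_product_le[OF _ assms])
qed (use assms mass_random_variable[of 0] in auto)

lemma integrable_mass:
  assumes "x \<in> verts G"
  shows "integrable P (\<lambda>\<omega>. M 0 \<omega> x)"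
proof (rule integrable_const_bound)
  show "AE \<omega> in P. norm (M 0 \<omega> x) \<le> real (card (verts G))"
    using AE_unit_mean_configs[OF order_refl]
  proof eventually_elim
    case (elim \<omega>)
    then show ?case
      using unit_mean_config_le[OF elim assms] assms by (simp add: unit_mean_configs_def)
  qed
qed (use assms mass_random_variable[of 0] in auto)

text \<open>
A hit acts linearly on configurations, hence it acts on products of two masses by the tensor square
of its matrix. Taking means in the generator identity for \<open>m x * m y\<close> gives the balance equation.
\<close>

lemma pair_moment_balanced:
  "balanced (verts G \<times> verts G) (pair_kernel G) (real (card (verts G))) pair_moment"
  unfolding balanced_def
proof
  fix q assume "q \<in> verts G \<times> verts G"
  then obtain x y where q: "q = (x, y)" and x: "x \<in> verts G" and y: "y \<in> verts G" by blast
  define f where "f m = m x * m y" for m :: "'v \<Rightarrow> real"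
  have f: "f \<in> borel_measurable (config_space G)"
    unfolding f_def using measurable_mass_at x y by auto
  have "(\<Sum>v\<in>verts G. expectation (\<lambda>\<omega>. f (meteor_hit G v (M 0 \<omega>))))
      = real (card (verts G)) * expectation (\<lambda>\<omega>. f (M 0 \<omega>))"
  proof (rule stationary_generator[OF f, where C = "(real (card (verts G)))\<^sup>2"])
    show "verts G \<noteq> {}" using x by blast
    show "expectation (\<lambda>\<omega>. f (M h \<omega>)) = expectation (\<lambda>\<omega>. f (M 0 \<omega>))" if "0 < h" for h
      using integral_distr[OF mass_measurable[of h] f] integral_distr[OF mass_measurable[of 0] f]
        stationary_law[of h] stationary_law[of 0] that by simp
    show "AE \<omega> in P. \<bar>f (M h \<omega>)\<bar> \<le> (real (card (verts G)))\<^sup>2" if "0 \<le> h" for h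
      using AE_unit_mean_configs[OF that] unfolding f_def
      by eventually_elim (rule abs_mass_product_le[OF _ x y])
    show "AE \<omega> in P. \<bar>f (meteor_hit G v (M 0 \<omega>))\<bar> \<le> (real (card (verts G)))\<^sup>2" if "v \<in> verts G" for v
      using AE_unit_mean_configs[OF order_refl] unfolding f_def
      by eventually_elim (rule abs_mass_product_le[OF meteor_hit_unit_mean_configs[OF _ that] x y])
  qed
  moreover have "expectation (\<lambda>\<omega>. f (meteor_hit G v (M 0 \<omega>)))
      = (\<Sum>p\<in>verts G \<times> verts G. pair_moment p * (hit_coeff G v x (fst p) * hit_coeff G v y (snd p)))"
    if v: "v \<in> verts G" for v
  proof -
    have "f (meteor_hit G v m)
        = (\<Sum>p\<in>verts G \<times> verts G. (m (fst p) * m (snd p)) * (hit_coeff G v x (fst p) * hit_coeff G v y (snd p)))" for m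
      unfolding f_def meteor_hit_eq_sum[OF v x] meteor_hit_eq_sum[OF v y] sum_product sum.cartesian_product
      by (intro sum.cong) (auto simp: mult_ac)
    then have "expectation (\<lambda>\<omega>. f (meteor_hit G v (M 0 \<omega>)))
        = (\<Sum>p\<in>verts G \<times> verts G. expectation (\<lambda>\<omega>. (M 0 \<omega> (fst p) * M 0 \<omega> (snd p))
            * (hit_coeff G v x (fst p) * hit_coeff G v y (snd p))))"
      using integrable_mass_product
      by (simp only:) (intro Bochner_Integration.integral_sum integrable_mult_left, auto)
    then show ?thesis by (simp only: pair_moment_def integral_mult_left_zero)
  qed
  ultimately have "(\<Sum>v\<in>verts G. \<Sum>p\<in>verts G \<times> verts G.
        pair_moment p * (hit_coeff G v x (fst p) * hit_coeff G v y (snd p)))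
      = real (card (verts G)) * pair_moment (x, y)"
    by (simp add: pair_moment_def f_def)
  also have "(\<Sum>v\<in>verts G. \<Sum>p\<in>verts G \<times> verts G.
        pair_moment p * (hit_coeff G v x (fst p) * hit_coeff G v y (snd p)))
      = (\<Sum>p\<in>verts G \<times> verts G. pair_moment p * pair_kernel G p q)"
    unfolding pair_kernel_def sum_distrib_left q fst_conv snd_conv by (rule sum.swap)
  finally show "(\<Sum>p\<in>verts G \<times> verts G. pair_moment p * pair_kernel G p q)
      = real (card (verts G)) * pair_moment q"
    by (simp only: q)
qed

lemma pair_moment_row_sum:
  assumes "x \<in> verts G"
  shows "(\<Sum>y\<in>verts G. pair_moment (x, y)) = real (card (verts G)) * expectation (\<lambda>\<omega>. M 0 \<omega> x)"
proof -
  have "(\<Sum>y\<in>verts G. pair_moment (x, y)) = expectation (\<lambda>\<omega>. \<Sum>y\<in>verts G. M 0 \<omega> x * M 0 \<omega> y)"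
    unfolding pair_moment_def fst_conv snd_conv
    using integrable_mass_product[OF assms] by (intro Bochner_Integration.integral_sum[symmetric]) auto
  also have "\<dots> = expectation (\<lambda>\<omega>. M 0 \<omega> x * real (card (verts G)))"
  proof (rule integral_cong_AE)
    show "AE \<omega> in P. (\<Sum>y\<in>verts G. M 0 \<omega> x * M 0 \<omega> y) = M 0 \<omega> x * real (card (verts G))"
      using initial_mass by eventually_elim (simp flip: sum_distrib_left)
  qed (use assms mass_random_variable[of 0] in \<open>auto intro!: borel_measurable_sum borel_measurable_times\<close>)
  finally show ?thesis by simp
qed

lemma pair_moment_mass:
  "(\<Sum>p\<in>verts G \<times> verts G. pair_moment p) = (real (card (verts G)))\<^sup>2"
proof -
  have "(\<Sum>p\<in>verts G \<times> verts G. pair_moment p) = (\<Sum>x\<in>verts G. \<Sum>y\<in>verts G. pair_moment (x, y))"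
    by (simp add: sum.cartesian_product)
  also have "\<dots> = real (card (verts G)) * (\<Sum>x\<in>verts G. expectation (\<lambda>\<omega>. M 0 \<omega> x))"
    by (simp add: pair_moment_row_sum sum_distrib_left)
  also have "(\<Sum>x\<in>verts G. expectation (\<lambda>\<omega>. M 0 \<omega> x)) = expectation (\<lambda>\<omega>. \<Sum>x\<in>verts G. M 0 \<omega> x)"
    using integrable_mass by (intro Bochner_Integration.integral_sum[symmetric]) auto
  also have "\<dots> = expectation (\<lambda>\<omega>. real (card (verts G)))"
    using initial_mass mass_random_variable[of 0]
    by (intro integral_cong_AE) (auto intro!: borel_measurable_sum)
  finally show ?thesis by (simp add: power2_eq_square prob_space)
qed

text \<open>
The row sum of \<open>x\<close> in the moment matrix is the mean at \<open>x\<close> times the total mass \<open>n\<close>, and it equals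
\<open>n\<close>.
\<close>

lemma mean_mass:
  assumes "x \<in> verts G"
  shows "expectation (\<lambda>\<omega>. M 0 \<omega> x) = 1"
proof -
  have "real (card (verts G)) * expectation (\<lambda>\<omega>. M 0 \<omega> x) = real (card (verts G))"
    using pair_moment_row_sum[OF assms] balanced_row_sum[OF pair_moment_balanced pair_moment_mass assms] by simp
  then show ?thesis using two_vertices by auto
qed

lemma stationary_variance:
  assumes "x \<in> verts G"
  shows "prob_space.variance Q (\<lambda>m. m x) = pair_moment (x, x) - 1"
proof -
  have Q: "Q = distr P (config_space G) (M 0)" using stationary_law[of 0] by simp
  note [measurable] = measurable_mass_at[OF assms] mass_measurable[of 0]
  have "prob_space.variance Q (\<lambda>m. m x) = variance (\<lambda>\<omega>. M 0 \<omega> x)"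
    unfolding Q by (simp add: integral_distr)
  also have "\<dots> = pair_moment (x, x) - 1"
    using integrable_mass[OF assms] integrable_mass_product[OF assms assms] mean_mass[OF assms]
    by (subst variance_eq) (auto simp: pair_moment_def power2_eq_square)
  finally show ?thesis .
qed

end

theorem theorem6p1:
  fixes G :: "('v, 'e) pre_digraph" and \<rho> :: nat
    and P :: "'w measure" and N :: "'v \<Rightarrow> real \<Rightarrow> 'w \<Rightarrow> nat"
    and M :: "real \<Rightarrow> 'w \<Rightarrow> 'v \<Rightarrow> real" and Q :: "('v \<Rightarrow> real) measure" and x :: 'v
  assumes "graph G" and "Digraph_Component.connected G" and "2 \<le> card (verts G)"
    and "distance_transitive G" and "regular_graph G \<rho>"
    and "meteor_process G P N M"
    and "AE \<omega> in P. (\<Sum>v\<in>verts G. M 0 \<omega> v) = real (card (verts G))"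
    and "stationary_distribution G P M Q"
    and "x \<in> verts G"
  shows "prob_space.variance Q (\<lambda>m. m x)
    \<le> (real \<rho> + 1) / (real \<rho> - 1 + 2 * real \<rho> / (real (card (verts G)) - 1))"
proof -
  interpret graph G by fact
  interpret meteor_process G P N M by fact
  interpret stationary_meteor_process G \<rho> P N M Q
    by unfold_locales (use assms in auto)
  have "0 \<le> pair_moment (v, v)" for v by (simp add: pair_moment_def)
  from balanced_diagonal_bound[OF pair_moment_balanced this pair_moment_mass \<open>x \<in> verts G\<close>]
  show ?thesis by (simp only: stationary_variance[OF \<open>x \<in> verts G\<close>])
qed

end
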